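(* Each tight braided bimonoidal category is adjoint equivalent to a right permbraided category via strong braided bimonoidal functors. That is, for each tight braided bimonoidal category $C$ there exist a right permbraided category $A$ and an adjoint equivalence between the categories $C$ and $A$ in which both functors are strong braided bimonoidal functors.
   Context: Write $AB$ for $A\otimes B$; $\otimes$ binds tighter than $\oplus$. A bimonoidal category is a category $C$ with a symmetric monoidal structure $(\oplus,0,\alpha^\oplus,\lambda^\oplus,\rho^\oplus,\zeta^\oplus)$, a monoidal structure $(\otimes,1,\alpha^\otimes,\lambda^\otimes,\rho^\otimes)$ (with $\alpha_{A,B,C}:(AB)C\to A(BC)$, $\lambda_A$, $\rho_A$ the left/right unit isomorphisms), natural isomorphisms $\lambda^\bullet_A:0A\to0$, $\rho^\bullet_A:A0\to 0$, and natural monomorphisms $\delta^l_{A,B,C}:A(B\oplus C)\to AB\oplus AC$, $\delta^r_{A,B,C}:(A\oplus B)C\to AC\oplus BC$, such that for all objects: $\delta^l_{A,C,B}(1\otimes\zeta^\oplus_{B,C})=\zeta^\oplus_{AB,AC}\delta^l_{A,B,C}$; $\delta^r_{B,A,C}(\zeta^\oplus_{A,B}\otimes1)=\zeta^\oplus_{AC,BC}\delta^r_{A,B,C}$; $\alpha^\oplus(\delta^r_{A,B,D}\oplus1)\delta^r_{A\oplus B,C,D}=(1\oplus\delta^r_{B,C,D})\delta^r_{A,B\oplus C,D}(\alpha^\oplus_{A,B,C}\otimes1)$; $\alpha^\oplus(\delta^l_{A,B,C}\oplus1)\delta^l_{A,B\oplus C,D}=(1\oplus\delta^l_{A,C,D})\delta^l_{A,B,C\oplus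 D}(1\otimes\alpha^\oplus_{B,C,D})$; $\delta^l_{A,BC,BD}(1\otimes\delta^l_{B,C,D})\alpha^\otimes_{A,B,C\oplus D}=(\alpha^\otimes_{A,B,C}\oplus\alpha^\otimes_{A,B,D})\delta^l_{AB,C,D}$; $(\alpha^\otimes_{A,C,D}\oplus\alpha^\otimes_{B,C,D})\delta^r_{AC,BC,D}(\delta^r_{A,B,C}\otimes1)=\delta^r_{A,B,CD}\alpha^\otimes_{A\oplus B,C,D}$; $(\alpha^\otimes_{A,B,D}\oplus\alpha^\otimes_{A,C,D})\delta^r_{AB,AC,D}(\delta^l_{A,B,C}\otimes1)=\delta^l_{A,BD,CD}(1\otimes\delta^r_{B,C,D})\alpha^\otimes_{A,B\oplus C,D}$; $\mu(\delta^l_{A,C,D}\oplus\delta^l_{B,C,D})\delta^r_{A,B,C\oplus D}=(\delta^r_{A,B,C}\oplus\delta^r_{A,B,D})\delta^l_{A\oplus B,C,D}$, where $\mu:(AC\oplus AD)\oplus(BC\oplus BD)\to(AC\oplus BC)\oplus(AD\oplus BD)$ is the coherence isomorphism exchanging the two middle summands; $\lambda^\bullet_0=\rho^\bullet_0$; $\lambda^\oplus_0(\lambda^\bullet_A\oplus\lambda^\bullet_B)\delta^l_{0,A,B}=\lambda^\bullet_{A\oplus B}$; $\lambda^\oplus_0(\rho^\bullet_A\oplus\rho^\bullet_B)\delta^r_{A,B,0}=\rho^\bullet_{A\oplus B}$; $\rho^\otimes_0=\lambda^\bullet_1$; $\lambda^\otimes_0=\rho^\bullet_1$; $\lambda^\bullet_{AB}\alpha^\otimes_{0,A,B}=\lambda^\bullet_B(\lambda^\bullet_A\otimes1)$;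 $\rho^\bullet_A(1\otimes\lambda^\bullet_B)\alpha^\otimes_{A,0,B}=\lambda^\bullet_B(\rho^\bullet_A\otimes1)$; $\rho^\bullet_A(1\otimes\rho^\bullet_B)\alpha^\otimes_{A,B,0}=\rho^\bullet_{AB}$; $\lambda^\oplus_{AB}(\rho^\bullet_A\oplus1)\delta^l_{A,0,B}=1\otimes\lambda^\oplus_B$; $\lambda^\oplus_{BA}(\lambda^\bullet_A\oplus1)\delta^r_{0,B,A}=\lambda^\oplus_B\otimes1$; $\rho^\oplus_{AB}(1\oplus\rho^\bullet_A)\delta^l_{A,B,0}=1\otimes\rho^\oplus_B$; $\rho^\oplus_{AB}(1\oplus\lambda^\bullet_B)\delta^r_{A,0,B}=\rho^\oplus_A\otimes1$; $(\lambda^\otimes_A\oplus\lambda^\otimes_B)\delta^l_{1,A,B}=\lambda^\otimes_{A\oplus B}$; $(\rho^\otimes_A\oplus\rho^\otimes_B)\delta^r_{A,B,1}=\rho^\otimes_{A\oplus B}$. It is tight if $\delta^l,\delta^r$ are natural isomorphisms. A braided bimonoidal category is a bimonoidal category with a braiding $\zeta^\otimes$ making $\otimes$ braided monoidal, such that $\delta^l_{C,A,B}\zeta^\otimes_{A\oplus B,C}=(\zeta^\otimes_{A,C}\oplus\zeta^\otimes_{B,C})\delta^r_{A,B,C}$, $\delta^r_{B,C,A}\zeta^\otimes_{A,B\oplus C}=(\zeta^\otimes_{A,B}\oplus\zeta^\otimes_{A,C})\delta^l_{A,B,C}$, $\lambda^\bullet_A\zeta^\otimes_{A,0}=\rho^\bullet_A$,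 and $\rho^\bullet_A\zeta^\otimes_{0,A}=\lambda^\bullet_A$. A right permbraided category is a tight braided bimonoidal category whose additive and multiplicative structures are both strict monoidal, and for which $\lambda^\bullet$, $\rho^\bullet$, $\delta^r$, $\zeta^\otimes_{-,0}$ and $\zeta^\otimes_{0,-}$ are identities. A braided bimonoidal functor $F:C\to D$ is a functor with a symmetric monoidal structure $(F^2_\oplus,F^0_\oplus)$ with respect to $\oplus$ and a braided monoidal structure $(F^2_\otimes,F^0_\otimes)$ with respect to $\otimes$ (lax direction: $FA\otimes FB\to F(A\otimes B)$, $1\to F1$, etc.) such that $F(\lambda^\bullet_A)F^2_\otimes(F^0_\oplus\otimes1_{FA})=F^0_\oplus\lambda^\bullet_{FA}$ and $F(\delta^l_{A,B,C})F^2_\otimes(1\otimes F^2_\oplus)=F^2_\oplus(F^2_\otimes\oplus F^2_\otimes)\delta^l_{FA,FB,FC}$. It is strong if $F^2_\oplus,F^0_\oplus,F^2_\otimes,F^0_\otimes$ are all isomorphisms. *)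

theory Defs
  imports Main
begin

section \<open>Categories, functors, natural isomorphisms\<close>

text \<open>
  \<open>Comp C g f\<close> is the composite of \<open>f\<close> followed by \<open>g\<close>. It is only meaningful for composable
  arrows of \<open>C\<close>, and likewise all structure maps below are only constrained on objects and arrows
  of the category, never on junk values of the underlying types.
\<close>

record ('o, 'm) cat_data =
  Obj :: "'o set"
  Arr :: "'m set"
  Dom :: "'m \<Rightarrow> 'o"
  Cod :: "'m \<Rightarrow> 'o"
  Id :: "'o \<Rightarrow> 'm"
  Comp :: "'m \<Rightarrow> 'm \<Rightarrow> 'm"

definition hom :: "('o, 'm, 'x) cat_data_scheme \<Rightarrow> 'o \<Rightarrow> 'o \<Rightarrow> 'm set" where
  "hom C A B = {f \<in> Arr C. Dom C f = A \<and> Cod C f = B}"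

locale category =
  fixes C :: "('o, 'm, 'x) cat_data_scheme"
  assumes Dom_Obj: "f \<in> Arr C \<Longrightarrow> Dom C f \<in> Obj C"
    and Cod_Obj: "f \<in> Arr C \<Longrightarrow> Cod C f \<in> Obj C"
    and Id_hom: "A \<in> Obj C \<Longrightarrow> Id C A \<in> hom C A A"
    and Comp_hom: "f \<in> hom C A B \<Longrightarrow> g \<in> hom C B D \<Longrightarrow> Comp C g f \<in> hom C A D"
    and Comp_Id: "f \<in> hom C A B \<Longrightarrow> Comp C f (Id C A) = f"
    and Id_Comp: "f \<in> hom C A B \<Longrightarrow> Comp C (Id C B) f = f"
    and Comp_assoc: "f \<in> hom C A B \<Longrightarrow> g \<in> hom C B D \<Longrightarrow> h \<in> hom C D E \<Longrightarrow>
      Comp C (Comp C h g) f = Comp C h (Comp C g f)"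

definition inverse_arrows :: "('o, 'm, 'x) cat_data_scheme \<Rightarrow> 'm \<Rightarrow> 'm \<Rightarrow> bool" where
  "inverse_arrows C f g \<longleftrightarrow>
     f \<in> Arr C \<and> g \<in> hom C (Cod C f) (Dom C f) \<and>
     Comp C g f = Id C (Dom C f) \<and> Comp C f g = Id C (Cod C f)"

definition iso :: "('o, 'm, 'x) cat_data_scheme \<Rightarrow> 'm \<Rightarrow> bool" where
  "iso C f \<longleftrightarrow> (\<exists>g. inverse_arrows C f g)"

definition inverse_arrow :: "('o, 'm, 'x) cat_data_scheme \<Rightarrow> 'm \<Rightarrow> 'm" where
  "inverse_arrow C f = (THE g. inverse_arrows C f g)"

definition mono_arrow :: "('o, 'm, 'x) cat_data_scheme \<Rightarrow> 'm \<Rightarrow> bool" where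
  "mono_arrow C f \<longleftrightarrow> f \<in> Arr C \<and>
     (\<forall>A. \<forall>g \<in> hom C A (Dom C f). \<forall>h \<in> hom C A (Dom C f). Comp C f g = Comp C f h \<longrightarrow> g = h)"

record ('o, 'm, 'p, 'q) fun_data =
  onObj :: "'o \<Rightarrow> 'p"
  onArr :: "'m \<Rightarrow> 'q"

locale cat_functor = source: category C + target: category D
  for C :: "('o, 'm, 'x) cat_data_scheme" and D :: "('p, 'q, 'y) cat_data_scheme" +
  fixes F :: "('o, 'm, 'p, 'q, 'z) fun_data_scheme"
  assumes onObj: "A \<in> Obj C \<Longrightarrow> onObj F A \<in> Obj D"
    and onArr: "f \<in> hom C A B \<Longrightarrow> onArr F f \<in> hom D (onObj F A) (onObj F B)"
    and onArr_Id: "A \<in> Obj C \<Longrightarrow> onArr F (Id C A) = Id D (onObj F A)"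
    and onArr_Comp: "f \<in> hom C A B \<Longrightarrow> g \<in> hom C B E \<Longrightarrow>
      onArr F (Comp C g f) = Comp D (onArr F g) (onArr F f)"

text \<open>
  Functors \<open>F : C \<rightarrow> D\<close> and \<open>G : D \<rightarrow> C\<close> with natural isomorphisms
  \<open>\<eta> : 1 \<rightarrow> GF\<close> and \<open>\<epsilon> : FG \<rightarrow> 1\<close> satisfying the triangle identities.
\<close>

locale adjoint_equivalence =
  F: cat_functor C D F + G: cat_functor D C G
  for C :: "('o, 'm, 'x) cat_data_scheme" and D :: "('p, 'q, 'y) cat_data_scheme"
    and F :: "('o, 'm, 'p, 'q, 'z) fun_data_scheme"
    and G :: "('p, 'q, 'o, 'm, 'w) fun_data_scheme" +
  fixes \<eta> :: "'o \<Rightarrow> 'm" and \<epsilon> :: "'p \<Rightarrow> 'q"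
  assumes unit_hom: "A \<in> Obj C \<Longrightarrow> \<eta> A \<in> hom C A (onObj G (onObj F A))"
    and unit_iso: "A \<in> Obj C \<Longrightarrow> iso C (\<eta> A)"
    and unit_natural: "f \<in> hom C A B \<Longrightarrow>
      Comp C (\<eta> B) f = Comp C (onArr G (onArr F f)) (\<eta> A)"
    and counit_hom: "X \<in> Obj D \<Longrightarrow> \<epsilon> X \<in> hom D (onObj F (onObj G X)) X"
    and counit_iso: "X \<in> Obj D \<Longrightarrow> iso D (\<epsilon> X)"
    and counit_natural: "g \<in> hom D X Y \<Longrightarrow>
      Comp D (\<epsilon> Y) (onArr F (onArr G g)) = Comp D g (\<epsilon> X)"
    and triangle_F: "A \<in> Obj C \<Longrightarrow>
      Comp D (\<epsilon> (onObj F A)) (onArr F (\<eta> A)) = Id D (onObj F A)"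
    and triangle_G: "X \<in> Obj D \<Longrightarrow>
      Comp C (onArr G (\<epsilon> X)) (\<eta> (onObj G X)) = Id C (onObj G X)"


section \<open>Monoidal, braided and symmetric monoidal categories\<close>

record ('o, 'm) mon_data =
  tensor :: "'o \<Rightarrow> 'o \<Rightarrow> 'o"
  tensor_arr :: "'m \<Rightarrow> 'm \<Rightarrow> 'm"
  unit_obj :: "'o"
  assoc :: "'o \<Rightarrow> 'o \<Rightarrow> 'o \<Rightarrow> 'm"
  lunit :: "'o \<Rightarrow> 'm"
  runit :: "'o \<Rightarrow> 'm"

locale monoidal_syntax =
  fixes C :: "('o, 'm, 'x) cat_data_scheme" and M :: "('o, 'm) mon_data"
begin

abbreviation comp (infixr \<open>\<cdot>\<close> 55) where "g \<cdot> f \<equiv> Comp C g f"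
abbreviation ident (\<open>\<one>\<^sub>_\<close> [1000] 1000) where "\<one>\<^sub>A \<equiv> Id C A"
abbreviation tens (infixr \<open>\<otimes>\<close> 70) where "A \<otimes> B \<equiv> tensor M A B"
abbreviation tensa (infixr \<open>\<boxtimes>\<close> 70) where "f \<boxtimes> g \<equiv> tensor_arr M f g"
abbreviation I where "I \<equiv> unit_obj M"
abbreviation \<alpha> where "\<alpha> \<equiv> assoc M"
abbreviation lu where "lu \<equiv> lunit M"
abbreviation ru where "ru \<equiv> runit M"

end

locale monoidal_category = category C + monoidal_syntax C M
  for C :: "('o, 'm, 'x) cat_data_scheme" and M :: "('o, 'm) mon_data" +
  assumes unit_Obj: "I \<in> Obj C"
    and tensor_Obj: "A \<in> Obj C \<Longrightarrow> B \<in> Obj C \<Longrightarrow> A \<otimes> B \<in> Obj C"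
    and tensor_hom: "f \<in> hom C A A' \<Longrightarrow> g \<in> hom C B B' \<Longrightarrow> f \<boxtimes> g \<in> hom C (A \<otimes> B) (A' \<otimes> B')"
    and tensor_Id: "A \<in> Obj C \<Longrightarrow> B \<in> Obj C \<Longrightarrow> \<one>\<^sub>A \<boxtimes> \<one>\<^sub>B = Id C (A \<otimes> B)"
    and tensor_Comp:
      "f \<in> hom C A A' \<Longrightarrow> f' \<in> hom C A' A'' \<Longrightarrow> g \<in> hom C B B' \<Longrightarrow> g' \<in> hom C B' B'' \<Longrightarrow>
        (f' \<cdot> f) \<boxtimes> (g' \<cdot> g) = (f' \<boxtimes> g') \<cdot> (f \<boxtimes> g)"
    and assoc_hom: "A \<in> Obj C \<Longrightarrow> B \<in> Obj C \<Longrightarrow> D \<in> Obj C \<Longrightarrow>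
      \<alpha> A B D \<in> hom C ((A \<otimes> B) \<otimes> D) (A \<otimes> (B \<otimes> D))"
    and assoc_iso: "A \<in> Obj C \<Longrightarrow> B \<in> Obj C \<Longrightarrow> D \<in> Obj C \<Longrightarrow> iso C (\<alpha> A B D)"
    and assoc_natural:
      "f \<in> hom C A A' \<Longrightarrow> g \<in> hom C B B' \<Longrightarrow> h \<in> hom C D D' \<Longrightarrow>
        \<alpha> A' B' D' \<cdot> ((f \<boxtimes> g) \<boxtimes> h) = (f \<boxtimes> (g \<boxtimes> h)) \<cdot> \<alpha> A B D"
    and lunit_hom: "A \<in> Obj C \<Longrightarrow> lu A \<in> hom C (I \<otimes> A) A"
    and lunit_iso: "A \<in> Obj C \<Longrightarrow> iso C (lu A)"
    and lunit_natural: "f \<in> hom C A B \<Longrightarrow> lu B \<cdot> (\<one>\<^sub>I \<boxtimes> f) = f \<cdot> lu A"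
    and runit_hom: "A \<in> Obj C \<Longrightarrow> ru A \<in> hom C (A \<otimes> I) A"
    and runit_iso: "A \<in> Obj C \<Longrightarrow> iso C (ru A)"
    and runit_natural: "f \<in> hom C A B \<Longrightarrow> ru B \<cdot> (f \<boxtimes> \<one>\<^sub>I) = f \<cdot> ru A"
    and pentagon: "A \<in> Obj C \<Longrightarrow> B \<in> Obj C \<Longrightarrow> D \<in> Obj C \<Longrightarrow> E \<in> Obj C \<Longrightarrow>
      (\<one>\<^sub>A \<boxtimes> \<alpha> B D E) \<cdot> \<alpha> A (B \<otimes> D) E \<cdot> (\<alpha> A B D \<boxtimes> \<one>\<^sub>E) = \<alpha> A B (D \<otimes> E) \<cdot> \<alpha> (A \<otimes> B) D E"
    and triangle: "A \<in> Obj C \<Longrightarrow> B \<in> Obj C \<Longrightarrow> (\<one>\<^sub>A \<boxtimes> lu B) \<cdot> \<alpha> A I B = ru A \<boxtimes> \<one>\<^sub>B"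

text \<open>Strict: all components of \<open>\<alpha>\<close>, \<open>\<lambda>\<close>, \<open>\<rho>\<close> are identity arrows, so in particular
  \<open>\<otimes>\<close> is strictly associative and unital on objects.\<close>

locale strict_monoidal_category = monoidal_category +
  assumes strict_assoc: "A \<in> Obj C \<Longrightarrow> B \<in> Obj C \<Longrightarrow> D \<in> Obj C \<Longrightarrow>
      (A \<otimes> B) \<otimes> D = A \<otimes> (B \<otimes> D) \<and> \<alpha> A B D = Id C (A \<otimes> (B \<otimes> D))"
    and strict_lunit: "A \<in> Obj C \<Longrightarrow> I \<otimes> A = A \<and> lu A = \<one>\<^sub>A"
    and strict_runit: "A \<in> Obj C \<Longrightarrow> A \<otimes> I = A \<and> ru A = \<one>\<^sub>A"

locale braided_monoidal_category = monoidal_category C M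
  for C :: "('o, 'm, 'x) cat_data_scheme" and M :: "('o, 'm) mon_data" +
  fixes \<zeta> :: "'o \<Rightarrow> 'o \<Rightarrow> 'm"
  assumes braid_hom: "A \<in> Obj C \<Longrightarrow> B \<in> Obj C \<Longrightarrow> \<zeta> A B \<in> hom C (A \<otimes> B) (B \<otimes> A)"
    and braid_iso: "A \<in> Obj C \<Longrightarrow> B \<in> Obj C \<Longrightarrow> iso C (\<zeta> A B)"
    and braid_natural: "f \<in> hom C A A' \<Longrightarrow> g \<in> hom C B B' \<Longrightarrow>
      \<zeta> A' B' \<cdot> (f \<boxtimes> g) = (g \<boxtimes> f) \<cdot> \<zeta> A B"
    and hexagon1: "A \<in> Obj C \<Longrightarrow> B \<in> Obj C \<Longrightarrow> D \<in> Obj C \<Longrightarrow>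
      \<alpha> B D A \<cdot> \<zeta> A (B \<otimes> D) \<cdot> \<alpha> A B D = (\<one>\<^sub>B \<boxtimes> \<zeta> A D) \<cdot> \<alpha> B A D \<cdot> (\<zeta> A B \<boxtimes> \<one>\<^sub>D)"
    and hexagon2: "A \<in> Obj C \<Longrightarrow> B \<in> Obj C \<Longrightarrow> D \<in> Obj C \<Longrightarrow>
      \<zeta> (A \<otimes> B) D =
        \<alpha> D A B \<cdot> (\<zeta> A D \<boxtimes> \<one>\<^sub>B) \<cdot> inverse_arrow C (\<alpha> A D B) \<cdot> (\<one>\<^sub>A \<boxtimes> \<zeta> B D) \<cdot> \<alpha> A B D"

locale symmetric_monoidal_category = braided_monoidal_category +
  assumes symmetry: "A \<in> Obj C \<Longrightarrow> B \<in> Obj C \<Longrightarrow> \<zeta> B A \<cdot> \<zeta> A B = Id C (A \<otimes> B)"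

text \<open>
  \<open>F2 A B : FA \<otimes> FB \<rightarrow> F(A \<otimes> B)\<close> and \<open>F0 : I \<rightarrow> FI\<close> (lax direction). A symmetric monoidal functor
  is a braided monoidal functor between symmetric monoidal categories.
\<close>

locale braided_monoidal_functor =
  cat_functor C D F +
  S: braided_monoidal_category C M \<beta> + T: braided_monoidal_category D N \<gamma>
  for C :: "('o, 'm, 'x) cat_data_scheme" and M :: "('o, 'm) mon_data" and \<beta>
    and D :: "('p, 'q, 'y) cat_data_scheme" and N :: "('p, 'q) mon_data" and \<gamma>
    and F :: "('o, 'm, 'p, 'q, 'z) fun_data_scheme" +
  fixes F2 :: "'o \<Rightarrow> 'o \<Rightarrow> 'q" and F0 :: "'q"
  assumes F0_hom: "F0 \<in> hom D (unit_obj N) (onObj F (unit_obj M))"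
    and F2_hom: "A \<in> Obj C \<Longrightarrow> B \<in> Obj C \<Longrightarrow>
      F2 A B \<in> hom D (tensor N (onObj F A) (onObj F B)) (onObj F (tensor M A B))"
    and F2_natural: "f \<in> hom C A A' \<Longrightarrow> g \<in> hom C B B' \<Longrightarrow>
      Comp D (F2 A' B') (tensor_arr N (onArr F f) (onArr F g)) =
      Comp D (onArr F (tensor_arr M f g)) (F2 A B)"
    and F2_assoc: "A \<in> Obj C \<Longrightarrow> B \<in> Obj C \<Longrightarrow> E \<in> Obj C \<Longrightarrow>
      Comp D (onArr F (assoc M A B E))
        (Comp D (F2 (tensor M A B) E) (tensor_arr N (F2 A B) (Id D (onObj F E)))) =
      Comp D (F2 A (tensor M B E))
        (Comp D (tensor_arr N (Id D (onObj F A)) (F2 B E))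
          (assoc N (onObj F A) (onObj F B) (onObj F E)))"
    and F2_lunit: "A \<in> Obj C \<Longrightarrow>
      Comp D (onArr F (lunit M A))
        (Comp D (F2 (unit_obj M) A) (tensor_arr N F0 (Id D (onObj F A)))) =
      lunit N (onObj F A)"
    and F2_runit: "A \<in> Obj C \<Longrightarrow>
      Comp D (onArr F (runit M A))
        (Comp D (F2 A (unit_obj M)) (tensor_arr N (Id D (onObj F A)) F0)) =
      runit N (onObj F A)"
    and F2_braid: "A \<in> Obj C \<Longrightarrow> B \<in> Obj C \<Longrightarrow>
      Comp D (F2 B A) (\<gamma> (onObj F A) (onObj F B)) = Comp D (onArr F (\<beta> A B)) (F2 A B)"

locale symmetric_monoidal_functor =
  braided_monoidal_functor C M \<beta> D N \<gamma> F F2 F0 +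
  S: symmetric_monoidal_category C M \<beta> + T: symmetric_monoidal_category D N \<gamma>
  for C :: "('o, 'm, 'x) cat_data_scheme" and M :: "('o, 'm) mon_data" and \<beta>
    and D :: "('p, 'q, 'y) cat_data_scheme" and N :: "('p, 'q) mon_data" and \<gamma>
    and F :: "('o, 'm, 'p, 'q, 'z) fun_data_scheme" and F2 F0


section \<open>Braided bimonoidal categories\<close>

record ('o, 'm) bimon_data = "('o, 'm) cat_data" +
  add :: "('o, 'm) mon_data"
  add_sym :: "'o \<Rightarrow> 'o \<Rightarrow> 'm"
  mult :: "('o, 'm) mon_data"
  lnull :: "'o \<Rightarrow> 'm"
  rnull :: "'o \<Rightarrow> 'm"
  ldist :: "'o \<Rightarrow> 'o \<Rightarrow> 'o \<Rightarrow> 'm"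
  rdist :: "'o \<Rightarrow> 'o \<Rightarrow> 'o \<Rightarrow> 'm"

record ('o, 'm) braided_bimon_data = "('o, 'm) bimon_data" +
  mult_braid :: "'o \<Rightarrow> 'o \<Rightarrow> 'm"

text \<open>
  \<open>\<oplus>\<close>, \<open>\<otimes>\<close> act on objects and \<open>\<boxplus>\<close>, \<open>\<boxtimes>\<close> on arrows. \<open>l0\<close>, \<open>r0\<close> are the zero isomorphisms
  \<open>\<lambda>\<^sup>\<bullet>\<close>, \<open>\<rho>\<^sup>\<bullet>\<close>. The interchange \<open>\<mu> W X Y V : (W \<oplus> X) \<oplus> (Y \<oplus> V) \<rightarrow> (W \<oplus> Y) \<oplus> (X \<oplus> V)\<close> is one
  of the (by coherence equal) composites of associators and the symmetry of \<open>X\<close> and \<open>Y\<close>.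
\<close>

locale bimonoidal_syntax =
  fixes C :: "('o, 'm, 'x) bimon_data_scheme"
begin

abbreviation comp (infixr \<open>\<cdot>\<close> 55) where "g \<cdot> f \<equiv> Comp C g f"
abbreviation ident (\<open>\<one>\<^sub>_\<close> [1000] 1000) where "\<one>\<^sub>A \<equiv> Id C A"
abbreviation plus (infixr \<open>\<oplus>\<close> 65) where "A \<oplus> B \<equiv> tensor (add C) A B"
abbreviation plusa (infixr \<open>\<boxplus>\<close> 65) where "f \<boxplus> g \<equiv> tensor_arr (add C) f g"
abbreviation Z where "Z \<equiv> unit_obj (add C)"
abbreviation \<alpha>p where "\<alpha>p \<equiv> assoc (add C)"
abbreviation lp where "lp \<equiv> lunit (add C)"
abbreviation rp where "rp \<equiv> runit (add C)"
abbreviation \<zeta>p where "\<zeta>p \<equiv> add_sym C"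
abbreviation times (infixr \<open>\<otimes>\<close> 70) where "A \<otimes> B \<equiv> tensor (mult C) A B"
abbreviation timesa (infixr \<open>\<boxtimes>\<close> 70) where "f \<boxtimes> g \<equiv> tensor_arr (mult C) f g"
abbreviation U where "U \<equiv> unit_obj (mult C)"
abbreviation \<alpha>t where "\<alpha>t \<equiv> assoc (mult C)"
abbreviation lt where "lt \<equiv> lunit (mult C)"
abbreviation rt where "rt \<equiv> runit (mult C)"
abbreviation l0 where "l0 \<equiv> lnull C"
abbreviation r0 where "r0 \<equiv> rnull C"
abbreviation \<delta>l where "\<delta>l \<equiv> ldist C"
abbreviation \<delta>r where "\<delta>r \<equiv> rdist C"

definition \<mu> :: "'o \<Rightarrow> 'o \<Rightarrow> 'o \<Rightarrow> 'o \<Rightarrow> 'm" where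
  "\<mu> W X Y V =
     inverse_arrow C (\<alpha>p W Y (X \<oplus> V)) \<cdot>
     (\<one>\<^sub>W \<boxplus> (\<alpha>p Y X V \<cdot> (\<zeta>p X Y \<boxplus> \<one>\<^sub>V) \<cdot> inverse_arrow C (\<alpha>p X Y V))) \<cdot>
     \<alpha>p W X (Y \<oplus> V)"

end

locale bimonoidal_category = bimonoidal_syntax C
  for C :: "('o, 'm, 'x) bimon_data_scheme" +
  assumes add_symmetric: "symmetric_monoidal_category C (add C) (add_sym C)"
    and mult_monoidal: "monoidal_category C (mult C)"
    and lnull_hom: "A \<in> Obj C \<Longrightarrow> l0 A \<in> hom C (Z \<otimes> A) Z"
    and lnull_iso: "A \<in> Obj C \<Longrightarrow> iso C (l0 A)"
    and lnull_natural: "f \<in> hom C A B \<Longrightarrow> l0 B \<cdot> (\<one>\<^sub>Z \<boxtimes> f) = l0 A"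
    and rnull_hom: "A \<in> Obj C \<Longrightarrow> r0 A \<in> hom C (A \<otimes> Z) Z"
    and rnull_iso: "A \<in> Obj C \<Longrightarrow> iso C (r0 A)"
    and rnull_natural: "f \<in> hom C A B \<Longrightarrow> r0 B \<cdot> (f \<boxtimes> \<one>\<^sub>Z) = r0 A"
    and ldist_hom: "\<lbrakk>A \<in> Obj C; B \<in> Obj C; D \<in> Obj C\<rbrakk> \<Longrightarrow>
      \<delta>l A B D \<in> hom C (A \<otimes> (B \<oplus> D)) (A \<otimes> B \<oplus> A \<otimes> D)"
    and ldist_mono: "\<lbrakk>A \<in> Obj C; B \<in> Obj C; D \<in> Obj C\<rbrakk> \<Longrightarrow> mono_arrow C (\<delta>l A B D)"
    and ldist_natural: "\<lbrakk>f \<in> hom C A A'; g \<in> hom C B B'; h \<in> hom C D D'\<rbrakk> \<Longrightarrow>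
      \<delta>l A' B' D' \<cdot> (f \<boxtimes> (g \<boxplus> h)) = (f \<boxtimes> g \<boxplus> f \<boxtimes> h) \<cdot> \<delta>l A B D"
    and rdist_hom: "\<lbrakk>A \<in> Obj C; B \<in> Obj C; D \<in> Obj C\<rbrakk> \<Longrightarrow>
      \<delta>r A B D \<in> hom C ((A \<oplus> B) \<otimes> D) (A \<otimes> D \<oplus> B \<otimes> D)"
    and rdist_mono: "\<lbrakk>A \<in> Obj C; B \<in> Obj C; D \<in> Obj C\<rbrakk> \<Longrightarrow> mono_arrow C (\<delta>r A B D)"
    and rdist_natural: "\<lbrakk>f \<in> hom C A A'; g \<in> hom C B B'; h \<in> hom C D D'\<rbrakk> \<Longrightarrow>
      \<delta>r A' B' D' \<cdot> ((f \<boxplus> g) \<boxtimes> h) = (f \<boxtimes> h \<boxplus> g \<boxtimes> h) \<cdot> \<delta>r A B D"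
    and ldist_sym: "\<lbrakk>A \<in> Obj C; B \<in> Obj C; D \<in> Obj C\<rbrakk> \<Longrightarrow>
      \<delta>l A D B \<cdot> (\<one>\<^sub>A \<boxtimes> \<zeta>p B D) = \<zeta>p (A \<otimes> B) (A \<otimes> D) \<cdot> \<delta>l A B D"
    and rdist_sym: "\<lbrakk>A \<in> Obj C; B \<in> Obj C; D \<in> Obj C\<rbrakk> \<Longrightarrow>
      \<delta>r B A D \<cdot> (\<zeta>p A B \<boxtimes> \<one>\<^sub>D) = \<zeta>p (A \<otimes> D) (B \<otimes> D) \<cdot> \<delta>r A B D"
    and rdist_add_assoc: "\<lbrakk>A \<in> Obj C; B \<in> Obj C; D \<in> Obj C; E \<in> Obj C\<rbrakk> \<Longrightarrow>
      \<alpha>p (A \<otimes> E) (B \<otimes> E) (D \<otimes> E) \<cdot> (\<delta>r A B E \<boxplus> Id C (D \<otimes> E)) \<cdot> \<delta>r (A \<oplus> B) D E =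
      (Id C (A \<otimes> E) \<boxplus> \<delta>r B D E) \<cdot> \<delta>r A (B \<oplus> D) E \<cdot> (\<alpha>p A B D \<boxtimes> \<one>\<^sub>E)"
    and ldist_add_assoc: "\<lbrakk>A \<in> Obj C; B \<in> Obj C; D \<in> Obj C; E \<in> Obj C\<rbrakk> \<Longrightarrow>
      \<alpha>p (A \<otimes> B) (A \<otimes> D) (A \<otimes> E) \<cdot> (\<delta>l A B D \<boxplus> Id C (A \<otimes> E)) \<cdot> \<delta>l A (B \<oplus> D) E =
      (Id C (A \<otimes> B) \<boxplus> \<delta>l A D E) \<cdot> \<delta>l A B (D \<oplus> E) \<cdot> (\<one>\<^sub>A \<boxtimes> \<alpha>p B D E)"
    and ldist_mult_assoc: "\<lbrakk>A \<in> Obj C; B \<in> Obj C; D \<in> Obj C; E \<in> Obj C\<rbrakk> \<Longrightarrow>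
      \<delta>l A (B \<otimes> D) (B \<otimes> E) \<cdot> (\<one>\<^sub>A \<boxtimes> \<delta>l B D E) \<cdot> \<alpha>t A B (D \<oplus> E) =
      (\<alpha>t A B D \<boxplus> \<alpha>t A B E) \<cdot> \<delta>l (A \<otimes> B) D E"
    and rdist_mult_assoc: "\<lbrakk>A \<in> Obj C; B \<in> Obj C; D \<in> Obj C; E \<in> Obj C\<rbrakk> \<Longrightarrow>
      (\<alpha>t A D E \<boxplus> \<alpha>t B D E) \<cdot> \<delta>r (A \<otimes> D) (B \<otimes> D) E \<cdot> (\<delta>r A B D \<boxtimes> \<one>\<^sub>E) =
      \<delta>r A B (D \<otimes> E) \<cdot> \<alpha>t (A \<oplus> B) D E"
    and ldist_rdist_mult_assoc: "\<lbrakk>A \<in> Obj C; B \<in> Obj C; D \<in> Obj C; E \<in> Obj C\<rbrakk> \<Longrightarrow>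
      (\<alpha>t A B E \<boxplus> \<alpha>t A D E) \<cdot> \<delta>r (A \<otimes> B) (A \<otimes> D) E \<cdot> (\<delta>l A B D \<boxtimes> \<one>\<^sub>E) =
      \<delta>l A (B \<otimes> E) (D \<otimes> E) \<cdot> (\<one>\<^sub>A \<boxtimes> \<delta>r B D E) \<cdot> \<alpha>t A (B \<oplus> D) E"
    and ldist_rdist: "\<lbrakk>A \<in> Obj C; B \<in> Obj C; D \<in> Obj C; E \<in> Obj C\<rbrakk> \<Longrightarrow>
      \<mu> (A \<otimes> D) (A \<otimes> E) (B \<otimes> D) (B \<otimes> E) \<cdot> (\<delta>l A D E \<boxplus> \<delta>l B D E) \<cdot> \<delta>r A B (D \<oplus> E) =
      (\<delta>r A B D \<boxplus> \<delta>r A B E) \<cdot> \<delta>l (A \<oplus> B) D E"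
    and null_null: "l0 Z = r0 Z"
    and lnull_ldist: "\<lbrakk>A \<in> Obj C; B \<in> Obj C\<rbrakk> \<Longrightarrow>
      lp Z \<cdot> (l0 A \<boxplus> l0 B) \<cdot> \<delta>l Z A B = l0 (A \<oplus> B)"
    and rnull_rdist: "\<lbrakk>A \<in> Obj C; B \<in> Obj C\<rbrakk> \<Longrightarrow>
      lp Z \<cdot> (r0 A \<boxplus> r0 B) \<cdot> \<delta>r A B Z = r0 (A \<oplus> B)"
    and runit_lnull: "rt Z = l0 U"
    and lunit_rnull: "lt Z = r0 U"
    and lnull_assoc: "\<lbrakk>A \<in> Obj C; B \<in> Obj C\<rbrakk> \<Longrightarrow>
      l0 (A \<otimes> B) \<cdot> \<alpha>t Z A B = l0 B \<cdot> (l0 A \<boxtimes> \<one>\<^sub>B)"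
    and lnull_rnull_assoc: "\<lbrakk>A \<in> Obj C; B \<in> Obj C\<rbrakk> \<Longrightarrow>
      r0 A \<cdot> (\<one>\<^sub>A \<boxtimes> l0 B) \<cdot> \<alpha>t A Z B = l0 B \<cdot> (r0 A \<boxtimes> \<one>\<^sub>B)"
    and rnull_assoc: "\<lbrakk>A \<in> Obj C; B \<in> Obj C\<rbrakk> \<Longrightarrow>
      r0 A \<cdot> (\<one>\<^sub>A \<boxtimes> r0 B) \<cdot> \<alpha>t A B Z = r0 (A \<otimes> B)"
    and ldist_add_lunit: "\<lbrakk>A \<in> Obj C; B \<in> Obj C\<rbrakk> \<Longrightarrow>
      lp (A \<otimes> B) \<cdot> (r0 A \<boxplus> Id C (A \<otimes> B)) \<cdot> \<delta>l A Z B = \<one>\<^sub>A \<boxtimes> lp B"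
    and rdist_add_lunit: "\<lbrakk>A \<in> Obj C; B \<in> Obj C\<rbrakk> \<Longrightarrow>
      lp (B \<otimes> A) \<cdot> (l0 A \<boxplus> Id C (B \<otimes> A)) \<cdot> \<delta>r Z B A = lp B \<boxtimes> \<one>\<^sub>A"
    and ldist_add_runit: "\<lbrakk>A \<in> Obj C; B \<in> Obj C\<rbrakk> \<Longrightarrow>
      rp (A \<otimes> B) \<cdot> (Id C (A \<otimes> B) \<boxplus> r0 A) \<cdot> \<delta>l A B Z = \<one>\<^sub>A \<boxtimes> rp B"
    and rdist_add_runit: "\<lbrakk>A \<in> Obj C; B \<in> Obj C\<rbrakk> \<Longrightarrow>
      rp (A \<otimes> B) \<cdot> (Id C (A \<otimes> B) \<boxplus> l0 B) \<cdot> \<delta>r A Z B = rp A \<boxtimes> \<one>\<^sub>B"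
    and ldist_mult_lunit: "\<lbrakk>A \<in> Obj C; B \<in> Obj C\<rbrakk> \<Longrightarrow>
      (lt A \<boxplus> lt B) \<cdot> \<delta>l U A B = lt (A \<oplus> B)"
    and rdist_mult_runit: "\<lbrakk>A \<in> Obj C; B \<in> Obj C\<rbrakk> \<Longrightarrow>
      (rt A \<boxplus> rt B) \<cdot> \<delta>r A B U = rt (A \<oplus> B)"

locale braided_bimonoidal_category = bimonoidal_category C
  for C :: "('o, 'm, 'x) braided_bimon_data_scheme" +
  assumes mult_braided: "braided_monoidal_category C (mult C) (mult_braid C)"
    and ldist_braid: "\<lbrakk>A \<in> Obj C; B \<in> Obj C; D \<in> Obj C\<rbrakk> \<Longrightarrow>
      \<delta>l D A B \<cdot> mult_braid C (A \<oplus> B) D = (mult_braid C A D \<boxplus> mult_braid C B D) \<cdot> \<delta>r A B D"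
    and rdist_braid: "\<lbrakk>A \<in> Obj C; B \<in> Obj C; D \<in> Obj C\<rbrakk> \<Longrightarrow>
      \<delta>r B D A \<cdot> mult_braid C A (B \<oplus> D) = (mult_braid C A B \<boxplus> mult_braid C A D) \<cdot> \<delta>l A B D"
    and lnull_braid: "A \<in> Obj C \<Longrightarrow> l0 A \<cdot> mult_braid C A Z = r0 A"
    and rnull_braid: "A \<in> Obj C \<Longrightarrow> r0 A \<cdot> mult_braid C Z A = l0 A"

locale tight_braided_bimonoidal_category = braided_bimonoidal_category C
  for C :: "('o, 'm, 'x) braided_bimon_data_scheme" +
  assumes ldist_iso: "\<lbrakk>A \<in> Obj C; B \<in> Obj C; D \<in> Obj C\<rbrakk> \<Longrightarrow> iso C (\<delta>l A B D)"
    and rdist_iso: "\<lbrakk>A \<in> Obj C; B \<in> Obj C; D \<in> Obj C\<rbrakk> \<Longrightarrow> iso C (\<delta>r A B D)"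

text \<open>
  That an arrow \<open>X \<rightarrow> Y\<close> is an identity is expressed by the equation of objects \<open>X = Y\<close> together with
  the equation of arrows.
\<close>

locale right_permbraided_category = tight_braided_bimonoidal_category C
  for C :: "('o, 'm, 'x) braided_bimon_data_scheme" +
  assumes add_strict: "strict_monoidal_category C (add C)"
    and mult_strict: "strict_monoidal_category C (mult C)"
    and lnull_identity: "A \<in> Obj C \<Longrightarrow> Z \<otimes> A = Z \<and> l0 A = \<one>\<^sub>Z"
    and rnull_identity: "A \<in> Obj C \<Longrightarrow> A \<otimes> Z = Z \<and> r0 A = \<one>\<^sub>Z"
    and rdist_identity: "\<lbrakk>A \<in> Obj C; B \<in> Obj C; D \<in> Obj C\<rbrakk> \<Longrightarrow>
      (A \<oplus> B) \<otimes> D = A \<otimes> D \<oplus> B \<otimes> D \<and> \<delta>r A B D = Id C (A \<otimes> D \<oplus> B \<otimes> D)"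
    and braid_null_identity: "A \<in> Obj C \<Longrightarrow> A \<otimes> Z = Z \<otimes> A \<and> mult_braid C A Z = Id C (Z \<otimes> A)"
    and null_braid_identity: "A \<in> Obj C \<Longrightarrow> Z \<otimes> A = A \<otimes> Z \<and> mult_braid C Z A = Id C (A \<otimes> Z)"


section \<open>Braided bimonoidal functors\<close>

record ('o, 'm, 'p, 'q) bimon_fun_data = "('o, 'm, 'p, 'q) fun_data" +
  add2 :: "'o \<Rightarrow> 'o \<Rightarrow> 'q"
  add0 :: "'q"
  mult2 :: "'o \<Rightarrow> 'o \<Rightarrow> 'q"
  mult0 :: "'q"

locale braided_bimonoidal_functor =
  source: braided_bimonoidal_category C + target: braided_bimonoidal_category D
  for C :: "('o, 'm, 'x) braided_bimon_data_scheme"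
    and D :: "('p, 'q, 'y) braided_bimon_data_scheme" +
  fixes F :: "('o, 'm, 'p, 'q, 'z) bimon_fun_data_scheme"
  assumes add_functor:
      "symmetric_monoidal_functor C (add C) (add_sym C) D (add D) (add_sym D) F (add2 F) (add0 F)"
    and mult_functor:
      "braided_monoidal_functor C (mult C) (mult_braid C) D (mult D) (mult_braid D) F
        (mult2 F) (mult0 F)"
    and functor_lnull: "A \<in> Obj C \<Longrightarrow>
      Comp D (onArr F (lnull C A))
        (Comp D (mult2 F (unit_obj (add C)) A)
          (tensor_arr (mult D) (add0 F) (Id D (onObj F A)))) =
      Comp D (add0 F) (lnull D (onObj F A))"
    and functor_ldist: "\<lbrakk>A \<in> Obj C; B \<in> Obj C; E \<in> Obj C\<rbrakk> \<Longrightarrow>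
      Comp D (onArr F (ldist C A B E))
        (Comp D (mult2 F A (tensor (add C) B E))
          (tensor_arr (mult D) (Id D (onObj F A)) (add2 F B E))) =
      Comp D (add2 F (tensor (mult C) A B) (tensor (mult C) A E))
        (Comp D (tensor_arr (add D) (mult2 F A B) (mult2 F A E))
          (ldist D (onObj F A) (onObj F B) (onObj F E)))"

locale strong_braided_bimonoidal_functor = braided_bimonoidal_functor C D F
  for C :: "('o, 'm, 'x) braided_bimon_data_scheme"
    and D :: "('p, 'q, 'y) braided_bimon_data_scheme"
    and F :: "('o, 'm, 'p, 'q, 'z) bimon_fun_data_scheme" +
  assumes add2_iso: "\<lbrakk>A \<in> Obj C; B \<in> Obj C\<rbrakk> \<Longrightarrow> iso D (add2 F A B)"
    and add0_iso: "iso D (add0 F)"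
    and mult2_iso: "\<lbrakk>A \<in> Obj C; B \<in> Obj C\<rbrakk> \<Longrightarrow> iso D (mult2 F A B)"
    and mult0_iso: "iso D (mult0 F)"


section \<open>A type for the objects of the strictification\<close>

text \<open>
  HOL cannot quantify existentially over types, so an existential statement about categories has to
  name the types from which objects and arrows are taken. Formal expressions in the objects of a
  given category are a type large enough for the objects; the object set of a category
  over this type may be any subset, and its operations need not be the constructors.
\<close>

datatype 'o rig_expr =
    Gen 'o
  | Zero
  | One
  | Plus "'o rig_expr" "'o rig_expr"
  | Times "'o rig_expr" "'o rig_expr"

end

theory Submission
  imports Defs
begin

text \<open>
  The strictification keeps the arrows of \<open>C\<close> and replaces its objects by formal polynomials: an object
  is a list of monomials, a monomial a list of objects of \<open>C\<close>, and an arrow between two polynomials is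
  an arrow of \<open>C\<close> between their values. Polynomials are added by concatenation and multiplied in
  lexicographic order, so both operations are strictly associative and unital, the empty sum is strictly
  absorbing, and multiplication distributes over addition strictly from the right. From the left it
  distributes only up to a permutation of summands, which is why the left distributor survives.

  There are canonical isomorphisms, called frames below, from the sum and the product of the values of
  two polynomials to the value of their sum and product. Any choice of frames allows
  one to carry all the structure of \<open>C\<close> over to polynomials, and every axiom is carried over with it: an
  equation between composites of structure maps in the new category is a conjugate of the same equation
  in \<open>C\<close> by frames. The same principle makes evaluation and its quasi-inverse, which sends an object to
  the corresponding one-letter polynomial, strong braided bimonoidal functors.

  What depends on the choice of frames is strictness: a transported structure map is an identity
  exactly when the frames are compatible with the original structure map. The frames are defined by
  recursion along the lists, from the additive associators, the distributors and the zero isomorphisms,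
  and each compatibility is an induction whose step rests on one of the axioms of \<open>C\<close>, rearranged by
  naturality. The compatibilities are \<open>join_assoc\<close> (hence \<open>add_frame_assoc\<close>), \<open>mult_frame_add_frame\<close> for the right distributor,
  \<open>mult_frame_assoc\<close>, \<open>mult_frame_lunit\<close>, \<open>mult_frame_runit\<close> and \<open>mult_frame_Nil\<close>. The braidings with the
  zero object become identities together with the zero isomorphisms, by the axiom that relates the two.
\<close>

section \<open>Isomorphisms and tensor products of arrows\<close>

text \<open>
  Typing is restated through domain and codomain so that the simplifier can discharge it; composites
  are normalised to the right and tensor products of arrows are merged.
\<close>

context category begin

lemma in_hom [simp]: "f \<in> hom C A B \<longleftrightarrow> f \<in> Arr C \<and> Dom C f = A \<and> Cod C f = B"
  by (auto simp: hom_def)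

lemma dom_cod_Obj [simp]: "f \<in> Arr C \<Longrightarrow> Dom C f \<in> Obj C" "f \<in> Arr C \<Longrightarrow> Cod C f \<in> Obj C"
  by (fact Dom_Obj Cod_Obj)+

lemma Id_typing [simp]:
  "A \<in> Obj C \<Longrightarrow> Id C A \<in> Arr C" "A \<in> Obj C \<Longrightarrow> Dom C (Id C A) = A"
  "A \<in> Obj C \<Longrightarrow> Cod C (Id C A) = A"
  using Id_hom by auto

lemma Comp_typing [simp]:
  assumes "f \<in> Arr C" "g \<in> Arr C" "Dom C g = Cod C f"
  shows "Comp C g f \<in> Arr C" "Dom C (Comp C g f) = Dom C f" "Cod C (Comp C g f) = Cod C g"
  using Comp_hom[of f "Dom C f" "Cod C f" g "Cod C g"] assms by auto

lemma Comp_Id_right [simp]: "f \<in> Arr C \<Longrightarrow> Dom C f = A \<Longrightarrow> Comp C f (Id C A) = f"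
  using Comp_Id by auto

lemma Comp_Id_left [simp]: "f \<in> Arr C \<Longrightarrow> Cod C f = B \<Longrightarrow> Comp C (Id C B) f = f"
  using Id_Comp by auto

lemma Comp_assoc' [simp]:
  "f \<in> Arr C \<Longrightarrow> g \<in> Arr C \<Longrightarrow> h \<in> Arr C \<Longrightarrow> Dom C g = Cod C f \<Longrightarrow> Dom C h = Cod C g \<Longrightarrow>
    Comp C (Comp C h g) f = Comp C h (Comp C g f)"
  using Comp_assoc by auto

text \<open>
  Applies an equation of two-arrow composites inside a longer right-nested composite.
\<close>

lemma extend_right:
  assumes "Comp C g f = Comp C k h"
    and "g \<in> Arr C" "f \<in> Arr C" "k \<in> Arr C" "h \<in> Arr C" "x \<in> Arr C"
    and "Dom C g = Cod C f" "Dom C k = Cod C h" "Cod C x = Dom C f" "Cod C x = Dom C h"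
  shows "Comp C g (Comp C f x) = Comp C k (Comp C h x)"
proof -
  have "Comp C (Comp C g f) x = Comp C (Comp C k h) x"
    by (simp only: assms(1))
  then show ?thesis using assms(2-) by simp
qed

lemma inverse_arrows_unique:
  assumes "inverse_arrows C f g" "inverse_arrows C f g'"
  shows "g = g'"
proof -
  have "Comp C (Comp C g f) g' = Comp C g (Comp C f g')"
    using assms by (intro Comp_assoc') (auto simp: inverse_arrows_def)
  then show ?thesis
    using assms by (auto simp: inverse_arrows_def)
qed

lemma inverse_arrowI: "inverse_arrows C f g \<Longrightarrow> inverse_arrow C f = g"
  unfolding inverse_arrow_def by (rule the_equality) (auto intro: inverse_arrows_unique)

lemma inverse_arrows_inverse: "iso C f \<Longrightarrow> inverse_arrows C f (inverse_arrow C f)"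
  using inverse_arrowI unfolding iso_def by auto

lemma iso_typing [simp]:
  assumes "iso C f"
  shows "f \<in> Arr C" "inverse_arrow C f \<in> Arr C"
    "Dom C (inverse_arrow C f) = Cod C f" "Cod C (inverse_arrow C f) = Dom C f"
  using inverse_arrows_inverse[OF assms] by (auto simp: inverse_arrows_def)

lemma inverse_cancel [simp]:
  assumes "iso C f"
  shows "Comp C (inverse_arrow C f) f = Id C (Dom C f)"
    "Comp C f (inverse_arrow C f) = Id C (Cod C f)"
    "x \<in> Arr C \<Longrightarrow> Cod C x = Dom C f \<Longrightarrow> Comp C (inverse_arrow C f) (Comp C f x) = x"
    "y \<in> Arr C \<Longrightarrow> Cod C y = Cod C f \<Longrightarrow> Comp C f (Comp C (inverse_arrow C f) y) = y"
proof -
  show 1: "Comp C (inverse_arrow C f) f = Id C (Dom C f)"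
    and 2: "Comp C f (inverse_arrow C f) = Id C (Cod C f)"
    using inverse_arrows_inverse[OF assms] by (auto simp: inverse_arrows_def)
  show "x \<in> Arr C \<Longrightarrow> Cod C x = Dom C f \<Longrightarrow> Comp C (inverse_arrow C f) (Comp C f x) = x"
    using 1 assms by (subst Comp_assoc'[symmetric]) auto
  show "y \<in> Arr C \<Longrightarrow> Cod C y = Cod C f \<Longrightarrow> Comp C f (Comp C (inverse_arrow C f) y) = y"
    using 2 assms by (subst Comp_assoc'[symmetric]) auto
qed

lemma inverse_arrowsI:
  assumes "f \<in> Arr C" "g \<in> Arr C" "Dom C g = Cod C f" "Cod C g = Dom C f"
    "Comp C g f = Id C (Dom C f)" "Comp C f g = Id C (Cod C f)"
  shows "inverse_arrows C f g"
  using assms by (simp add: inverse_arrows_def)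

lemma iso_Id [simp]: "A \<in> Obj C \<Longrightarrow> iso C (Id C A)"
  unfolding iso_def by (rule exI[of _ "Id C A"]) (simp add: inverse_arrows_def)

lemma inverse_Id [simp]: "A \<in> Obj C \<Longrightarrow> inverse_arrow C (Id C A) = Id C A"
  by (rule inverse_arrowI) (simp add: inverse_arrows_def)

lemma inverse_arrows_Comp:
  assumes "iso C f" "iso C g" "Dom C g = Cod C f"
  shows "inverse_arrows C (Comp C g f) (Comp C (inverse_arrow C f) (inverse_arrow C g))"
  using assms by (intro inverse_arrowsI) simp_all

lemma iso_Comp [simp]:
  "iso C f \<Longrightarrow> iso C g \<Longrightarrow> Dom C g = Cod C f \<Longrightarrow> iso C (Comp C g f)"
  unfolding iso_def[of C "Comp C g f"] by (rule exI, rule inverse_arrows_Comp)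

lemma inverse_Comp [simp]:
  "iso C f \<Longrightarrow> iso C g \<Longrightarrow> Dom C g = Cod C f \<Longrightarrow>
    inverse_arrow C (Comp C g f) = Comp C (inverse_arrow C f) (inverse_arrow C g)"
  by (rule inverse_arrowI) (rule inverse_arrows_Comp)

lemma iso_inverse [simp]: "iso C f \<Longrightarrow> iso C (inverse_arrow C f)"
  unfolding iso_def[of C "inverse_arrow C f"]
  by (rule exI[of _ f], rule inverse_arrowsI) simp_all

lemma iso_cancel_right:
  assumes "iso C u" "f \<in> Arr C" "g \<in> Arr C" "Dom C f = Cod C u" "Dom C g = Cod C u"
    and eq: "Comp C f u = Comp C g u"
  shows "f = g"
proof -
  have "Comp C (Comp C f u) (inverse_arrow C u) = Comp C (Comp C g u) (inverse_arrow C u)"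
    using eq by simp
  then show ?thesis using assms(1-5) by simp
qed

lemma iso_cancel_left:
  assumes "iso C u" "f \<in> Arr C" "g \<in> Arr C" "Cod C f = Dom C u" "Cod C g = Dom C u"
    and eq: "Comp C u f = Comp C u g"
  shows "f = g"
proof -
  have "Comp C (inverse_arrow C u) (Comp C u f) = Comp C (inverse_arrow C u) (Comp C u g)"
    using eq by simp
  then show ?thesis using assms(1-5) by simp
qed

lemma iso_mono: "iso C f \<Longrightarrow> mono_arrow C f"
  unfolding mono_arrow_def by (auto intro: iso_cancel_left)

end

context monoidal_category begin

lemma tensor_typing [simp]:
  assumes "f \<in> Arr C" "g \<in> Arr C"
  shows "f \<boxtimes> g \<in> Arr C" "Dom C (f \<boxtimes> g) = Dom C f \<otimes> Dom C g"
    "Cod C (f \<boxtimes> g) = Cod C f \<otimes> Cod C g"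
  using tensor_hom[of f "Dom C f" "Cod C f" g "Dom C g" "Cod C g"] assms by auto

lemma assoc_typing [simp]:
  assumes "A \<in> Obj C" "B \<in> Obj C" "D \<in> Obj C"
  shows "\<alpha> A B D \<in> Arr C" "Dom C (\<alpha> A B D) = (A \<otimes> B) \<otimes> D" "Cod C (\<alpha> A B D) = A \<otimes> B \<otimes> D"
  using assoc_hom[OF assms] by auto

lemma unit_typing [simp]:
  assumes "A \<in> Obj C"
  shows "lu A \<in> Arr C" "Dom C (lu A) = I \<otimes> A" "Cod C (lu A) = A"
    "ru A \<in> Arr C" "Dom C (ru A) = A \<otimes> I" "Cod C (ru A) = A"
  using lunit_hom[OF assms] runit_hom[OF assms] by auto

declare unit_Obj [simp] tensor_Obj [simp] tensor_Id [simp]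
  assoc_iso [simp] lunit_iso [simp] runit_iso [simp]

lemma interchange [simp]:
  assumes "f \<in> Arr C" "f' \<in> Arr C" "g \<in> Arr C" "g' \<in> Arr C" "Dom C f' = Cod C f" "Dom C g' = Cod C g"
  shows "(f' \<boxtimes> g') \<cdot> (f \<boxtimes> g) = (f' \<cdot> f) \<boxtimes> (g' \<cdot> g)"
    "x \<in> Arr C \<Longrightarrow> Cod C x = Dom C f \<otimes> Dom C g \<Longrightarrow>
      (f' \<boxtimes> g') \<cdot> (f \<boxtimes> g) \<cdot> x = ((f' \<cdot> f) \<boxtimes> (g' \<cdot> g)) \<cdot> x"
proof -
  show "(f' \<boxtimes> g') \<cdot> (f \<boxtimes> g) = (f' \<cdot> f) \<boxtimes> (g' \<cdot> g)"
    using tensor_Comp[of f "Dom C f" "Cod C f" f' "Cod C f'" g "Dom C g" "Cod C g" g' "Cod C g'"] assms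
    by simp
  then show "x \<in> Arr C \<Longrightarrow> Cod C x = Dom C f \<otimes> Dom C g \<Longrightarrow>
      (f' \<boxtimes> g') \<cdot> (f \<boxtimes> g) \<cdot> x = ((f' \<cdot> f) \<boxtimes> (g' \<cdot> g)) \<cdot> x"
    using assms by (subst Comp_assoc'[symmetric]) auto
qed

lemma inverse_arrows_tensor:
  assumes "iso C f" "iso C g"
  shows "inverse_arrows C (f \<boxtimes> g) (inverse_arrow C f \<boxtimes> inverse_arrow C g)"
  using assms by (intro inverse_arrowsI) simp_all

lemma iso_tensor [simp]: "iso C f \<Longrightarrow> iso C g \<Longrightarrow> iso C (f \<boxtimes> g)"
  unfolding iso_def[of C "f \<boxtimes> g"] by (rule exI, rule inverse_arrows_tensor)

lemma inverse_tensor [simp]: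
  "iso C f \<Longrightarrow> iso C g \<Longrightarrow> inverse_arrow C (f \<boxtimes> g) = inverse_arrow C f \<boxtimes> inverse_arrow C g"
  by (rule inverse_arrowI) (rule inverse_arrows_tensor)

lemma assoc_nat:
  assumes "f \<in> Arr C" "g \<in> Arr C" "h \<in> Arr C" "Cod C f = A" "Cod C g = B" "Cod C h = D"
  shows "\<alpha> A B D \<cdot> ((f \<boxtimes> g) \<boxtimes> h) = (f \<boxtimes> (g \<boxtimes> h)) \<cdot> \<alpha> (Dom C f) (Dom C g) (Dom C h)"
    and "x \<in> Arr C \<Longrightarrow> Cod C x = (Dom C f \<otimes> Dom C g) \<otimes> Dom C h \<Longrightarrow>
      \<alpha> A B D \<cdot> ((f \<boxtimes> g) \<boxtimes> h) \<cdot> x = (f \<boxtimes> (g \<boxtimes> h)) \<cdot> \<alpha> (Dom C f) (Dom C g) (Dom C h) \<cdot> x"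
proof -
  show 1: "\<alpha> A B D \<cdot> ((f \<boxtimes> g) \<boxtimes> h) = (f \<boxtimes> (g \<boxtimes> h)) \<cdot> \<alpha> (Dom C f) (Dom C g) (Dom C h)"
    using assoc_natural assms by auto
  show "x \<in> Arr C \<Longrightarrow> Cod C x = (Dom C f \<otimes> Dom C g) \<otimes> Dom C h \<Longrightarrow>
      \<alpha> A B D \<cdot> ((f \<boxtimes> g) \<boxtimes> h) \<cdot> x = (f \<boxtimes> (g \<boxtimes> h)) \<cdot> \<alpha> (Dom C f) (Dom C g) (Dom C h) \<cdot> x"
    using assms by (intro extend_right[OF 1]) auto
qed

lemma lunit_nat:
  assumes "f \<in> Arr C" "Cod C f = A"
  shows "lu A \<cdot> (\<one>\<^sub>I \<boxtimes> f) = f \<cdot> lu (Dom C f)"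
  using lunit_natural[of f] assms by auto

lemma runit_nat:
  assumes "f \<in> Arr C" "Cod C f = A"
  shows "ru A \<cdot> (f \<boxtimes> \<one>\<^sub>I) = f \<cdot> ru (Dom C f)"
  using runit_natural[of f] assms by auto

text \<open>
  Tensoring with the unit is faithful because it is naturally isomorphic to the identity.
\<close>

lemma unit_tensor_cancel:
  assumes "f \<in> Arr C" "g \<in> Arr C" "Dom C f = Dom C g" "Cod C f = Cod C g"
  shows "\<one>\<^sub>I \<boxtimes> f = \<one>\<^sub>I \<boxtimes> g \<Longrightarrow> f = g" "f \<boxtimes> \<one>\<^sub>I = g \<boxtimes> \<one>\<^sub>I \<Longrightarrow> f = g"
proof -
  assume "\<one>\<^sub>I \<boxtimes> f = \<one>\<^sub>I \<boxtimes> g"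
  then have "f \<cdot> lu (Dom C f) = g \<cdot> lu (Dom C f)"
    using assms lunit_nat[of f] lunit_nat[of g] by simp
  then show "f = g" by (rule iso_cancel_right[rotated 5]) (use assms in auto)
next
  assume "f \<boxtimes> \<one>\<^sub>I = g \<boxtimes> \<one>\<^sub>I"
  then have "f \<cdot> ru (Dom C f) = g \<cdot> ru (Dom C f)"
    using assms runit_nat[of f] runit_nat[of g] by simp
  then show "f = g" by (rule iso_cancel_right[rotated 5]) (use assms in auto)
qed

text \<open>
  Kelly's observation: the pentagon and the triangle imply the remaining unit identities
  \<open>lunit_tensor\<close>, \<open>runit_tensor\<close> and \<open>lunit_unit_eq\<close>. Each is obtained by cancelling a tensor
  factor \<open>I\<close>, which provides the unit entries for the pentagon and the triangle.
\<close>

lemma lunit_tensor: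
  assumes [simp]: "A \<in> Obj C" "B \<in> Obj C"
  shows "lu (A \<otimes> B) \<cdot> \<alpha> I A B = lu A \<boxtimes> \<one>\<^sub>B"
proof (rule unit_tensor_cancel(1))
  let ?u = "\<alpha> I (I \<otimes> A) B \<cdot> (\<alpha> I I A \<boxtimes> \<one>\<^sub>B)"
  have "(\<one>\<^sub>I \<boxtimes> (lu (A \<otimes> B) \<cdot> \<alpha> I A B)) \<cdot> ?u = (\<one>\<^sub>I \<boxtimes> lu (A \<otimes> B)) \<cdot> (\<one>\<^sub>I \<boxtimes> \<alpha> I A B) \<cdot> ?u"
    by simp
  also have "\<dots> = ((\<one>\<^sub>I \<boxtimes> lu (A \<otimes> B)) \<cdot> \<alpha> I I (A \<otimes> B)) \<cdot> \<alpha> (I \<otimes> I) A B"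
    by (subst pentagon) simp_all
  also have "\<dots> = (ru I \<boxtimes> Id C (A \<otimes> B)) \<cdot> \<alpha> (I \<otimes> I) A B"
    by (subst triangle) simp_all
  also have "\<dots> = \<alpha> I A B \<cdot> ((ru I \<boxtimes> \<one>\<^sub>A) \<boxtimes> \<one>\<^sub>B)"
    by (subst assoc_nat) simp_all
  also have "\<dots> = \<alpha> I A B \<cdot> ((\<one>\<^sub>I \<boxtimes> lu A) \<boxtimes> \<one>\<^sub>B) \<cdot> (\<alpha> I I A \<boxtimes> \<one>\<^sub>B)"
    by (subst triangle[symmetric]) simp_all
  also have "\<dots> = (\<one>\<^sub>I \<boxtimes> (lu A \<boxtimes> \<one>\<^sub>B)) \<cdot> ?u"
    by (subst assoc_nat) simp_all
  finally show "\<one>\<^sub>I \<boxtimes> (lu (A \<otimes> B) \<cdot> \<alpha> I A B) = \<one>\<^sub>I \<boxtimes> (lu A \<boxtimes> \<one>\<^sub>B)"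
    by (rule iso_cancel_right[rotated 5]) simp_all
qed simp_all

lemma runit_tensor:
  assumes [simp]: "A \<in> Obj C" "B \<in> Obj C"
  shows "(\<one>\<^sub>A \<boxtimes> ru B) \<cdot> \<alpha> A B I = ru (A \<otimes> B)"
proof (rule unit_tensor_cancel(2)[symmetric])
  have "\<alpha> A B I \<cdot> (ru (A \<otimes> B) \<boxtimes> \<one>\<^sub>I) = \<alpha> A B I \<cdot> (Id C (A \<otimes> B) \<boxtimes> lu I) \<cdot> \<alpha> (A \<otimes> B) I I"
    by (subst triangle[symmetric]) simp_all
  also have "\<dots> = (\<one>\<^sub>A \<boxtimes> (\<one>\<^sub>B \<boxtimes> lu I)) \<cdot> \<alpha> A B (I \<otimes> I) \<cdot> \<alpha> (A \<otimes> B) I I"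
    by (rule extend_right, subst tensor_Id[symmetric], simp, simp, subst assoc_nat) simp_all
  also have "\<dots> = (\<one>\<^sub>A \<boxtimes> (\<one>\<^sub>B \<boxtimes> lu I)) \<cdot> (\<one>\<^sub>A \<boxtimes> \<alpha> B I I) \<cdot> \<alpha> A (B \<otimes> I) I \<cdot> (\<alpha> A B I \<boxtimes> \<one>\<^sub>I)"
    by (subst pentagon) simp_all
  also have "\<dots> = (\<one>\<^sub>A \<boxtimes> (ru B \<boxtimes> \<one>\<^sub>I)) \<cdot> \<alpha> A (B \<otimes> I) I \<cdot> (\<alpha> A B I \<boxtimes> \<one>\<^sub>I)"
    by (subst triangle[symmetric]) simp_all
  also have "\<dots> = \<alpha> A B I \<cdot> ((\<one>\<^sub>A \<boxtimes> ru B) \<boxtimes> \<one>\<^sub>I) \<cdot> (\<alpha> A B I \<boxtimes> \<one>\<^sub>I)"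
    by (subst assoc_nat) simp_all
  also have "\<dots> = \<alpha> A B I \<cdot> (((\<one>\<^sub>A \<boxtimes> ru B) \<cdot> \<alpha> A B I) \<boxtimes> \<one>\<^sub>I)"
    by simp
  finally show "ru (A \<otimes> B) \<boxtimes> \<one>\<^sub>I = ((\<one>\<^sub>A \<boxtimes> ru B) \<cdot> \<alpha> A B I) \<boxtimes> \<one>\<^sub>I"
    by (rule iso_cancel_left[rotated 5]) simp_all
qed simp_all

lemma lunit_unit_eq: "lu I = ru I"
proof (rule unit_tensor_cancel(2))
  have "lu I \<cdot> (\<one>\<^sub>I \<boxtimes> lu I) = lu I \<cdot> lu (I \<otimes> I)"
    using lunit_nat[of "lu I"] by simp
  then have "\<one>\<^sub>I \<boxtimes> lu I = lu (I \<otimes> I)"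
    by (rule iso_cancel_left[rotated 5]) simp_all
  then show "lu I \<boxtimes> \<one>\<^sub>I = ru I \<boxtimes> \<one>\<^sub>I"
    using triangle[of I I] lunit_tensor[of I I] by simp
qed simp_all

section \<open>Tensor products of lists\<close>

text \<open>
  Bracketed to the right and terminated by the unit, so that concatenation of lists only ever
  moves brackets and removes one unit. This is used for the sums as well as for the monomials.
\<close>

primrec fold_obj :: "'o list \<Rightarrow> 'o" where
  "fold_obj [] = I"
| "fold_obj (x # xs) = x \<otimes> fold_obj xs"

primrec join :: "'o list \<Rightarrow> 'o list \<Rightarrow> 'm" where
  "join [] ys = lu (fold_obj ys)"
| "join (x # xs) ys = (\<one>\<^sub>x \<boxtimes> join xs ys) \<cdot> \<alpha> x (fold_obj xs) (fold_obj ys)"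

lemma fold_obj_Obj [simp]: "set xs \<subseteq> Obj C \<Longrightarrow> fold_obj xs \<in> Obj C"
  by (induction xs) auto

lemma join_iso_typing:
  assumes "set xs \<subseteq> Obj C" "set ys \<subseteq> Obj C"
  shows "iso C (join xs ys) \<and> Dom C (join xs ys) = fold_obj xs \<otimes> fold_obj ys \<and>
    Cod C (join xs ys) = fold_obj (xs @ ys)"
  using assms by (induction xs) auto

lemma join_typing [simp]:
  assumes "set xs \<subseteq> Obj C" "set ys \<subseteq> Obj C"
  shows "iso C (join xs ys)" "join xs ys \<in> Arr C" "Dom C (join xs ys) = fold_obj xs \<otimes> fold_obj ys"
    "Cod C (join xs ys) = fold_obj (xs @ ys)"
  using join_iso_typing[OF assms] iso_typing(1) by auto

text \<open>
  This is what makes the associator of the strictified tensor product an identity. The empty list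
  needs \<open>lunit_tensor\<close>, the step is the pentagon.
\<close>

lemma join_assoc:
  assumes "set xs \<subseteq> Obj C" "set ys \<subseteq> Obj C" "set zs \<subseteq> Obj C"
  shows "join (xs @ ys) zs \<cdot> (join xs ys \<boxtimes> Id C (fold_obj zs)) =
    join xs (ys @ zs) \<cdot> (Id C (fold_obj xs) \<boxtimes> join ys zs) \<cdot> \<alpha> (fold_obj xs) (fold_obj ys) (fold_obj zs)"
  using assms
proof (induction xs)
  case Nil
  then have [simp]: "set ys \<subseteq> Obj C" "set zs \<subseteq> Obj C" by auto
  let ?Y = "fold_obj ys" and ?Z = "fold_obj zs"
  have "join ys zs \<cdot> (lu ?Y \<boxtimes> \<one>\<^sub>?Z) = join ys zs \<cdot> lu (?Y \<otimes> ?Z) \<cdot> \<alpha> I ?Y ?Z"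
    by (simp add: lunit_tensor)
  also have "\<dots> = lu (fold_obj (ys @ zs)) \<cdot> (\<one>\<^sub>I \<boxtimes> join ys zs) \<cdot> \<alpha> I ?Y ?Z"
    by (rule extend_right, subst lunit_nat) simp_all
  finally show ?case by simp
next
  case (Cons x xs)
  then have [simp]: "x \<in> Obj C" "set xs \<subseteq> Obj C" "set ys \<subseteq> Obj C" "set zs \<subseteq> Obj C" by auto
  let ?X = "fold_obj xs" and ?Y = "fold_obj ys" and ?Z = "fold_obj zs"
  have "join (x # xs @ ys) zs \<cdot> (join (x # xs) ys \<boxtimes> \<one>\<^sub>?Z) =
    (\<one>\<^sub>x \<boxtimes> join (xs @ ys) zs) \<cdot> \<alpha> x (fold_obj (xs @ ys)) ?Z \<cdot> ((\<one>\<^sub>x \<boxtimes> join xs ys) \<boxtimes> \<one>\<^sub>?Z) \<cdot> (\<alpha> x ?X ?Y \<boxtimes> \<one>\<^sub>?Z)"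
    by simp
  also have "\<dots> = (\<one>\<^sub>x \<boxtimes> join (xs @ ys) zs) \<cdot> (\<one>\<^sub>x \<boxtimes> (join xs ys \<boxtimes> \<one>\<^sub>?Z)) \<cdot> \<alpha> x (?X \<otimes> ?Y) ?Z \<cdot> (\<alpha> x ?X ?Y \<boxtimes> \<one>\<^sub>?Z)"
    by (subst assoc_nat) simp_all
  also have "\<dots> = (\<one>\<^sub>x \<boxtimes> (join (xs @ ys) zs \<cdot> (join xs ys \<boxtimes> \<one>\<^sub>?Z))) \<cdot> \<alpha> x (?X \<otimes> ?Y) ?Z \<cdot> (\<alpha> x ?X ?Y \<boxtimes> \<one>\<^sub>?Z)"
    by simp
  also have "\<dots> = (\<one>\<^sub>x \<boxtimes> (join xs (ys @ zs) \<cdot> (\<one>\<^sub>?X \<boxtimes> join ys zs) \<cdot> \<alpha> ?X ?Y ?Z)) \<cdot> \<alpha> x (?X \<otimes> ?Y) ?Z \<cdot> (\<alpha> x ?X ?Y \<boxtimes> \<one>\<^sub>?Z)"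
    by (subst Cons.IH) simp_all
  also have "\<dots> = (\<one>\<^sub>x \<boxtimes> (join xs (ys @ zs) \<cdot> (\<one>\<^sub>?X \<boxtimes> join ys zs))) \<cdot> (\<one>\<^sub>x \<boxtimes> \<alpha> ?X ?Y ?Z) \<cdot> \<alpha> x (?X \<otimes> ?Y) ?Z \<cdot> (\<alpha> x ?X ?Y \<boxtimes> \<one>\<^sub>?Z)"
    by simp
  also have "\<dots> = (\<one>\<^sub>x \<boxtimes> join xs (ys @ zs)) \<cdot> (\<one>\<^sub>x \<boxtimes> (\<one>\<^sub>?X \<boxtimes> join ys zs)) \<cdot> \<alpha> x ?X (?Y \<otimes> ?Z) \<cdot> \<alpha> (x \<otimes> ?X) ?Y ?Z"
    by (subst pentagon) simp_all
  also have "\<dots> = (\<one>\<^sub>x \<boxtimes> join xs (ys @ zs)) \<cdot> \<alpha> x ?X (fold_obj (ys @ zs)) \<cdot> (Id C (x \<otimes> ?X) \<boxtimes> join ys zs) \<cdot> \<alpha> (x \<otimes> ?X) ?Y ?Z"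
    by (rule arg_cong[where f = "Comp C _"], rule extend_right, subst tensor_Id[of x ?X, symmetric], simp, simp, subst assoc_nat) simp_all
  finally show ?case by simp
qed

lemma join_Nil: "set xs \<subseteq> Obj C \<Longrightarrow> join xs [] = ru (fold_obj xs)"
  by (induction xs) (simp_all add: lunit_unit_eq runit_tensor)

end

section \<open>Values and frames of polynomials\<close>

sublocale bimonoidal_category \<subseteq> P: symmetric_monoidal_category C "add C" "add_sym C"
  by (rule add_symmetric)

sublocale bimonoidal_category \<subseteq> T: monoidal_category C "mult C"
  by (rule mult_monoidal)

context bimonoidal_category begin

text \<open>The infix symbols are reserved for the two tensor products of a bimonoidal category.\<close>

no_notation P.comp (infixr \<open>\<cdot>\<close> 55) and T.comp (infixr \<open>\<cdot>\<close> 55)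
  and P.ident (\<open>\<one>\<^sub>_\<close> [1000] 1000) and T.ident (\<open>\<one>\<^sub>_\<close> [1000] 1000)
  and P.tens (infixr \<open>\<otimes>\<close> 70) and T.tens (infixr \<open>\<otimes>\<close> 70)
  and P.tensa (infixr \<open>\<boxtimes>\<close> 70) and T.tensa (infixr \<open>\<boxtimes>\<close> 70)

lemma null_typing [simp]:
  assumes "A \<in> Obj C"
  shows "l0 A \<in> Arr C" "Dom C (l0 A) = Z \<otimes> A" "Cod C (l0 A) = Z"
    "r0 A \<in> Arr C" "Dom C (r0 A) = A \<otimes> Z" "Cod C (r0 A) = Z"
  using lnull_hom[OF assms] rnull_hom[OF assms] by auto

lemma dist_typing [simp]:
  assumes "A \<in> Obj C" "B \<in> Obj C" "D \<in> Obj C"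
  shows "\<delta>l A B D \<in> Arr C" "Dom C (\<delta>l A B D) = A \<otimes> (B \<oplus> D)" "Cod C (\<delta>l A B D) = A \<otimes> B \<oplus> A \<otimes> D"
    "\<delta>r A B D \<in> Arr C" "Dom C (\<delta>r A B D) = (A \<oplus> B) \<otimes> D" "Cod C (\<delta>r A B D) = A \<otimes> D \<oplus> B \<otimes> D"
  using ldist_hom[OF assms] rdist_hom[OF assms] by auto

declare lnull_iso [simp] rnull_iso [simp]

lemma null_nat:
  assumes "f \<in> Arr C" "Cod C f = A"
  shows "l0 A \<cdot> (\<one>\<^sub>Z \<boxtimes> f) = l0 (Dom C f)" "r0 A \<cdot> (f \<boxtimes> \<one>\<^sub>Z) = r0 (Dom C f)"
  using lnull_natural[of f] rnull_natural[of f] assms by auto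

lemma ldist_nat:
  assumes "f \<in> Arr C" "g \<in> Arr C" "h \<in> Arr C" "Cod C f = A" "Cod C g = B" "Cod C h = D"
  shows "\<delta>l A B D \<cdot> (f \<boxtimes> (g \<boxplus> h)) = (f \<boxtimes> g \<boxplus> f \<boxtimes> h) \<cdot> \<delta>l (Dom C f) (Dom C g) (Dom C h)"
    and "x \<in> Arr C \<Longrightarrow> Cod C x = Dom C f \<otimes> (Dom C g \<oplus> Dom C h) \<Longrightarrow>
      \<delta>l A B D \<cdot> (f \<boxtimes> (g \<boxplus> h)) \<cdot> x = (f \<boxtimes> g \<boxplus> f \<boxtimes> h) \<cdot> \<delta>l (Dom C f) (Dom C g) (Dom C h) \<cdot> x"
proof -
  show 1: "\<delta>l A B D \<cdot> (f \<boxtimes> (g \<boxplus> h)) = (f \<boxtimes> g \<boxplus> f \<boxtimes> h) \<cdot> \<delta>l (Dom C f) (Dom C g) (Dom C h)"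
    using ldist_natural assms by auto
  show "x \<in> Arr C \<Longrightarrow> Cod C x = Dom C f \<otimes> (Dom C g \<oplus> Dom C h) \<Longrightarrow>
      \<delta>l A B D \<cdot> (f \<boxtimes> (g \<boxplus> h)) \<cdot> x = (f \<boxtimes> g \<boxplus> f \<boxtimes> h) \<cdot> \<delta>l (Dom C f) (Dom C g) (Dom C h) \<cdot> x"
    using assms by (intro P.extend_right[OF 1]) auto
qed

lemma rdist_nat:
  assumes "f \<in> Arr C" "g \<in> Arr C" "h \<in> Arr C" "Cod C f = A" "Cod C g = B" "Cod C h = D"
  shows "\<delta>r A B D \<cdot> ((f \<boxplus> g) \<boxtimes> h) = (f \<boxtimes> h \<boxplus> g \<boxtimes> h) \<cdot> \<delta>r (Dom C f) (Dom C g) (Dom C h)"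
    and "x \<in> Arr C \<Longrightarrow> Cod C x = (Dom C f \<oplus> Dom C g) \<otimes> Dom C h \<Longrightarrow>
      \<delta>r A B D \<cdot> ((f \<boxplus> g) \<boxtimes> h) \<cdot> x = (f \<boxtimes> h \<boxplus> g \<boxtimes> h) \<cdot> \<delta>r (Dom C f) (Dom C g) (Dom C h) \<cdot> x"
proof -
  show 1: "\<delta>r A B D \<cdot> ((f \<boxplus> g) \<boxtimes> h) = (f \<boxtimes> h \<boxplus> g \<boxtimes> h) \<cdot> \<delta>r (Dom C f) (Dom C g) (Dom C h)"
    using rdist_natural assms by auto
  show "x \<in> Arr C \<Longrightarrow> Cod C x = (Dom C f \<oplus> Dom C g) \<otimes> Dom C h \<Longrightarrow>
      \<delta>r A B D \<cdot> ((f \<boxplus> g) \<boxtimes> h) \<cdot> x = (f \<boxtimes> h \<boxplus> g \<boxtimes> h) \<cdot> \<delta>r (Dom C f) (Dom C g) (Dom C h) \<cdot> x"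
    using assms by (intro P.extend_right[OF 1]) auto
qed

abbreviation mon :: "'o list \<Rightarrow> 'o" where "mon \<equiv> T.fold_obj"

definition poly :: "'o list list \<Rightarrow> 'o" where
  "poly P = P.fold_obj (map mon P)"

definition polynomial :: "'o list list \<Rightarrow> bool" where
  "polynomial P \<longleftrightarrow> (\<forall>m \<in> set P. set m \<subseteq> Obj C)"

primrec poly_mult :: "'o list list \<Rightarrow> 'o list list \<Rightarrow> 'o list list" where
  "poly_mult [] Q = []"
| "poly_mult (m # P) Q = map ((@) m) Q @ poly_mult P Q"

definition add_frame :: "'o list list \<Rightarrow> 'o list list \<Rightarrow> 'm" where
  "add_frame P Q = P.join (map mon P) (map mon Q)"

text \<open>
  The frame of a product is built in two stages, a monomial times a polynomial by left distributivity
  and then a polynomial times a polynomial by right distributivity; the empty sums contribute the zero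
  isomorphisms.
\<close>

primrec scale_frame :: "'o list \<Rightarrow> 'o list list \<Rightarrow> 'm" where
  "scale_frame m [] = r0 (mon m)"
| "scale_frame m (n # Q) = (T.join m n \<boxplus> scale_frame m Q) \<cdot> \<delta>l (mon m) (mon n) (poly Q)"

primrec mult_frame :: "'o list list \<Rightarrow> 'o list list \<Rightarrow> 'm" where
  "mult_frame [] Q = l0 (poly Q)"
| "mult_frame (m # P) Q =
    add_frame (map ((@) m) Q) (poly_mult P Q) \<cdot> (scale_frame m Q \<boxplus> mult_frame P Q) \<cdot> \<delta>r (mon m) (poly P) (poly Q)"

lemma polynomial_simps [simp]:
  "polynomial []" "polynomial (m # P) \<longleftrightarrow> set m \<subseteq> Obj C \<and> polynomial P"
  "polynomial (P @ Q) \<longleftrightarrow> polynomial P \<and> polynomial Q"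
  by (auto simp: polynomial_def)

lemma polynomial_map_append [simp]:
  "set m \<subseteq> Obj C \<Longrightarrow> polynomial (map ((@) m) Q) \<longleftrightarrow> polynomial Q"
  by (auto simp: polynomial_def)

lemma append_comp [simp]: "(@) m \<circ> (@) n = (@) (m @ n)"
  by (rule ext) simp

lemma map_append_Nil [simp]: "map ((@) []) Q = Q"
  by (simp add: map_idI)

lemma polynomial_poly_mult [simp]: "polynomial P \<Longrightarrow> polynomial Q \<Longrightarrow> polynomial (poly_mult P Q)"
  by (induction P) auto

lemma poly_mult_append: "poly_mult (P @ Q) R = poly_mult P R @ poly_mult Q R"
  by (induction P) auto

lemma poly_mult_map_append: "poly_mult (map ((@) m) Q) R = map ((@) m) (poly_mult Q R)"
  by (induction Q) auto

lemma poly_mult_assoc: "poly_mult (poly_mult P Q) R = poly_mult P (poly_mult Q R)"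
  by (induction P) (auto simp: poly_mult_append poly_mult_map_append)

lemma poly_mult_units [simp]: "poly_mult [[]] Q = Q" "poly_mult P [[]] = P" "poly_mult P [] = []"
  by (induction P) (auto simp: map_idI)

lemma mon_image [simp]: "polynomial P \<Longrightarrow> mon ` set P \<subseteq> Obj C"
  by (auto simp: polynomial_def)

lemma poly_simps [simp]: "poly [] = Z" "poly (m # P) = mon m \<oplus> poly P"
  by (simp_all add: poly_def)

lemma poly_Obj [simp]: "polynomial P \<Longrightarrow> poly P \<in> Obj C"
  by (simp add: poly_def)

lemma add_frame_simps [simp]:
  "add_frame [] Q = lp (poly Q)"
  "add_frame (m # P) Q = (Id C (mon m) \<boxplus> add_frame P Q) \<cdot> \<alpha>p (mon m) (poly P) (poly Q)"
  by (simp_all add: poly_def add_frame_def)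

lemma add_frame_typing [simp]:
  assumes "polynomial P" "polynomial Q"
  shows "iso C (add_frame P Q)" "add_frame P Q \<in> Arr C" "Dom C (add_frame P Q) = poly P \<oplus> poly Q"
    "Cod C (add_frame P Q) = poly (P @ Q)"
  using assms by (simp_all add: add_frame_def poly_def)

lemma add_frame_assoc:
  assumes [simp]: "polynomial P" "polynomial Q" "polynomial R"
  shows "add_frame (P @ Q) R \<cdot> (add_frame P Q \<boxplus> Id C (poly R)) =
      add_frame P (Q @ R) \<cdot> (Id C (poly P) \<boxplus> add_frame Q R) \<cdot> \<alpha>p (poly P) (poly Q) (poly R)"
    and "x \<in> Arr C \<Longrightarrow> Cod C x = (poly P \<oplus> poly Q) \<oplus> poly R \<Longrightarrow>
      add_frame (P @ Q) R \<cdot> (add_frame P Q \<boxplus> Id C (poly R)) \<cdot> x =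
      add_frame P (Q @ R) \<cdot> (Id C (poly P) \<boxplus> add_frame Q R) \<cdot> \<alpha>p (poly P) (poly Q) (poly R) \<cdot> x"
proof -
  show 1: "add_frame (P @ Q) R \<cdot> (add_frame P Q \<boxplus> Id C (poly R)) =
      add_frame P (Q @ R) \<cdot> (Id C (poly P) \<boxplus> add_frame Q R) \<cdot> \<alpha>p (poly P) (poly Q) (poly R)"
    using P.join_assoc[of "map mon P" "map mon Q" "map mon R"] assms
    by (simp add: add_frame_def poly_def)
  show "x \<in> Arr C \<Longrightarrow> Cod C x = (poly P \<oplus> poly Q) \<oplus> poly R \<Longrightarrow>
      add_frame (P @ Q) R \<cdot> (add_frame P Q \<boxplus> Id C (poly R)) \<cdot> x =
      add_frame P (Q @ R) \<cdot> (Id C (poly P) \<boxplus> add_frame Q R) \<cdot> \<alpha>p (poly P) (poly Q) (poly R) \<cdot> x"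
    using P.extend_right[OF 1, of x] by simp
qed

lemma add_frame_Nil: "polynomial P \<Longrightarrow> add_frame P [] = rp (poly P)"
  using P.join_Nil[of "map mon P"] by (simp add: add_frame_def poly_def)

end

context tight_braided_bimonoidal_category begin

declare ldist_iso [simp] rdist_iso [simp]

lemma scale_iso_typing:
  assumes "set m \<subseteq> Obj C" "polynomial Q"
  shows "iso C (scale_frame m Q) \<and> Dom C (scale_frame m Q) = mon m \<otimes> poly Q \<and>
    Cod C (scale_frame m Q) = poly (map ((@) m) Q)"
  using assms by (induction Q) auto

lemma scale_typing [simp]:
  assumes "set m \<subseteq> Obj C" "polynomial Q"
  shows "iso C (scale_frame m Q)" "scale_frame m Q \<in> Arr C" "Dom C (scale_frame m Q) = mon m \<otimes> poly Q"
    "Cod C (scale_frame m Q) = poly (map ((@) m) Q)"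
  using scale_iso_typing[OF assms] P.iso_typing(1) by auto

lemma mult_frame_iso_typing:
  assumes "polynomial P" "polynomial Q"
  shows "iso C (mult_frame P Q) \<and> Dom C (mult_frame P Q) = poly P \<otimes> poly Q \<and>
    Cod C (mult_frame P Q) = poly (poly_mult P Q)"
  using assms by (induction P) auto

lemma mult_frame_typing [simp]:
  assumes "polynomial P" "polynomial Q"
  shows "iso C (mult_frame P Q)" "mult_frame P Q \<in> Arr C" "Dom C (mult_frame P Q) = poly P \<otimes> poly Q"
    "Cod C (mult_frame P Q) = poly (poly_mult P Q)"
  using mult_frame_iso_typing[OF assms] P.iso_typing(1) by auto

text \<open>
  Compatibility of the frames with the right distributor. The step combines the axiom relating the
  right distributor with the additive associator and associativity of the additive frames.
\<close>

lemma mult_frame_add_frame: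
  assumes "polynomial P" "polynomial Q" "polynomial R"
  shows "mult_frame (P @ Q) R \<cdot> (add_frame P Q \<boxtimes> Id C (poly R)) =
    add_frame (poly_mult P R) (poly_mult Q R) \<cdot> (mult_frame P R \<boxplus> mult_frame Q R) \<cdot> \<delta>r (poly P) (poly Q) (poly R)"
  using assms
proof (induction P)
  case Nil
  then have [simp]: "polynomial Q" "polynomial R" by auto
  let ?q = "poly Q" and ?r = "poly R"
  have "mult_frame Q R \<cdot> (lp ?q \<boxtimes> \<one>\<^sub>?r) = mult_frame Q R \<cdot> lp (?q \<otimes> ?r) \<cdot> (l0 ?r \<boxplus> Id C (?q \<otimes> ?r)) \<cdot> \<delta>r Z ?q ?r"
    by (simp add: rdist_add_lunit)
  also have "\<dots> = lp (poly (poly_mult Q R)) \<cdot> (\<one>\<^sub>Z \<boxplus> mult_frame Q R) \<cdot> (l0 ?r \<boxplus> Id C (?q \<otimes> ?r)) \<cdot> \<delta>r Z ?q ?r"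
    by (rule P.extend_right, subst P.lunit_nat) simp_all
  finally show ?case by simp
next
  case (Cons m P)
  then have [simp]: "set m \<subseteq> Obj C" "polynomial P" "polynomial Q" "polynomial R" by auto
  let ?m = "mon m" and ?p = "poly P" and ?q = "poly Q" and ?r = "poly R"
  let ?a = "add_frame (map ((@) m) R) (poly_mult (P @ Q) R)"
  have "mult_frame ((m # P) @ Q) R \<cdot> (add_frame (m # P) Q \<boxtimes> \<one>\<^sub>?r) =
    ?a \<cdot> (scale_frame m R \<boxplus> mult_frame (P @ Q) R) \<cdot> \<delta>r ?m (poly (P @ Q)) ?r \<cdot>
      ((\<one>\<^sub>?m \<boxplus> add_frame P Q) \<boxtimes> \<one>\<^sub>?r) \<cdot> (\<alpha>p ?m ?p ?q \<boxtimes> \<one>\<^sub>?r)"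
    by (simp add: poly_mult_append)
  also have "\<dots> = ?a \<cdot> (scale_frame m R \<boxplus> (mult_frame (P @ Q) R \<cdot> (add_frame P Q \<boxtimes> \<one>\<^sub>?r))) \<cdot> \<delta>r ?m (?p \<oplus> ?q) ?r \<cdot> (\<alpha>p ?m ?p ?q \<boxtimes> \<one>\<^sub>?r)"
    by (subst rdist_nat) (simp_all add: poly_mult_append)
  also have "\<dots> = ?a \<cdot> (Id C (poly (map ((@) m) R)) \<boxplus> add_frame (poly_mult P R) (poly_mult Q R)) \<cdot> (scale_frame m R \<boxplus> (mult_frame P R \<boxplus> mult_frame Q R)) \<cdot>
      (Id C (?m \<otimes> ?r) \<boxplus> \<delta>r ?p ?q ?r) \<cdot> \<delta>r ?m (?p \<oplus> ?q) ?r \<cdot> (\<alpha>p ?m ?p ?q \<boxtimes> \<one>\<^sub>?r)"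
    by (subst Cons.IH) (simp_all add: poly_mult_append)
  also have "\<dots> = ?a \<cdot> (Id C (poly (map ((@) m) R)) \<boxplus> add_frame (poly_mult P R) (poly_mult Q R)) \<cdot> (scale_frame m R \<boxplus> (mult_frame P R \<boxplus> mult_frame Q R)) \<cdot>
      \<alpha>p (?m \<otimes> ?r) (?p \<otimes> ?r) (?q \<otimes> ?r) \<cdot> (\<delta>r ?m ?p ?r \<boxplus> Id C (?q \<otimes> ?r)) \<cdot> \<delta>r (?m \<oplus> ?p) ?q ?r"
    by (subst rdist_add_assoc) (simp_all add: poly_mult_append)
  also have "\<dots> = ?a \<cdot> (Id C (poly (map ((@) m) R)) \<boxplus> add_frame (poly_mult P R) (poly_mult Q R)) \<cdot>
      \<alpha>p (poly (map ((@) m) R)) (poly (poly_mult P R)) (poly (poly_mult Q R)) \<cdot> ((scale_frame m R \<boxplus> mult_frame P R) \<boxplus> mult_frame Q R) \<cdot> (\<delta>r ?m ?p ?r \<boxplus> Id C (?q \<otimes> ?r)) \<cdot> \<delta>r (?m \<oplus> ?p) ?q ?r"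
    by (subst P.assoc_nat) (simp_all add: poly_mult_append)
  also have "\<dots> = add_frame (map ((@) m) R @ poly_mult P R) (poly_mult Q R) \<cdot> (add_frame (map ((@) m) R) (poly_mult P R) \<boxplus> Id C (poly (poly_mult Q R))) \<cdot>
     ((scale_frame m R \<boxplus> mult_frame P R) \<boxplus> mult_frame Q R) \<cdot> (\<delta>r ?m ?p ?r \<boxplus> Id C (?q \<otimes> ?r)) \<cdot> \<delta>r (?m \<oplus> ?p) ?q ?r"
    by (subst add_frame_assoc) (simp_all add: poly_mult_append)
  finally show ?case by simp
qed

text \<open>
  The analogue for the left distributor, available only when the left factor is a single monomial: for
  longer left factors the two sides list the summands in different orders.
\<close>

lemma scale_add_frame:
  assumes "set m \<subseteq> Obj C" "polynomial Q" "polynomial R"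
  shows "scale_frame m (Q @ R) \<cdot> (Id C (mon m) \<boxtimes> add_frame Q R) =
    add_frame (map ((@) m) Q) (map ((@) m) R) \<cdot> (scale_frame m Q \<boxplus> scale_frame m R) \<cdot> \<delta>l (mon m) (poly Q) (poly R)"
  using assms
proof (induction Q)
  case Nil
  then have [simp]: "set m \<subseteq> Obj C" "polynomial R" by auto
  let ?m = "mon m" and ?r = "poly R"
  have "scale_frame m R \<cdot> (\<one>\<^sub>?m \<boxtimes> lp ?r) = scale_frame m R \<cdot> lp (?m \<otimes> ?r) \<cdot> (r0 ?m \<boxplus> Id C (?m \<otimes> ?r)) \<cdot> \<delta>l ?m Z ?r"
    by (simp add: ldist_add_lunit)
  also have "\<dots> = lp (poly (map ((@) m) R)) \<cdot> (\<one>\<^sub>Z \<boxplus> scale_frame m R) \<cdot> (r0 ?m \<boxplus> Id C (?m \<otimes> ?r)) \<cdot> \<delta>l ?m Z ?r"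
    by (rule P.extend_right, subst P.lunit_nat) simp_all
  finally show ?case by simp
next
  case (Cons n Q)
  then have [simp]: "set m \<subseteq> Obj C" "set n \<subseteq> Obj C" "polynomial Q" "polynomial R" by auto
  let ?m = "mon m" and ?n = "mon n" and ?q = "poly Q" and ?r = "poly R" and ?j = "T.join m n"
  let ?a = "add_frame (map ((@) m) Q) (map ((@) m) R)" and ?mn = "Id C (mon (m @ n))"
  have "scale_frame m ((n # Q) @ R) \<cdot> (\<one>\<^sub>?m \<boxtimes> add_frame (n # Q) R) =
    (?j \<boxplus> scale_frame m (Q @ R)) \<cdot> \<delta>l ?m ?n (poly (Q @ R)) \<cdot>
      (\<one>\<^sub>?m \<boxtimes> (\<one>\<^sub>?n \<boxplus> add_frame Q R)) \<cdot> (\<one>\<^sub>?m \<boxtimes> \<alpha>p ?n ?q ?r)"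
    by simp
  also have "\<dots> = (?j \<boxplus> (scale_frame m (Q @ R) \<cdot> (\<one>\<^sub>?m \<boxtimes> add_frame Q R))) \<cdot> \<delta>l ?m ?n (?q \<oplus> ?r) \<cdot> (\<one>\<^sub>?m \<boxtimes> \<alpha>p ?n ?q ?r)"
    by (subst ldist_nat) simp_all
  also have "\<dots> = (?mn \<boxplus> ?a) \<cdot> (?j \<boxplus> (scale_frame m Q \<boxplus> scale_frame m R)) \<cdot>
      (Id C (?m \<otimes> ?n) \<boxplus> \<delta>l ?m ?q ?r) \<cdot> \<delta>l ?m ?n (?q \<oplus> ?r) \<cdot> (\<one>\<^sub>?m \<boxtimes> \<alpha>p ?n ?q ?r)"
    by (subst Cons.IH) simp_all
  also have "\<dots> = (?mn \<boxplus> ?a) \<cdot> (?j \<boxplus> (scale_frame m Q \<boxplus> scale_frame m R)) \<cdot>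
      \<alpha>p (?m \<otimes> ?n) (?m \<otimes> ?q) (?m \<otimes> ?r) \<cdot> (\<delta>l ?m ?n ?q \<boxplus> Id C (?m \<otimes> ?r)) \<cdot> \<delta>l ?m (?n \<oplus> ?q) ?r"
    by (subst ldist_add_assoc) simp_all
  also have "\<dots> = (?mn \<boxplus> ?a) \<cdot> \<alpha>p (mon (m @ n)) (poly (map ((@) m) Q)) (poly (map ((@) m) R)) \<cdot>
      ((?j \<boxplus> scale_frame m Q) \<boxplus> scale_frame m R) \<cdot> (\<delta>l ?m ?n ?q \<boxplus> Id C (?m \<otimes> ?r)) \<cdot> \<delta>l ?m (?n \<oplus> ?q) ?r"
    by (subst P.assoc_nat) simp_all
  finally show ?case by simp
qed

text \<open>
  The three lemmas \<open>scale_scale\<close>, \<open>mult_frame_scale\<close> and \<open>mult_frame_assoc\<close> establish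
  compatibility with the multiplicative associator for one more polynomial factor at a time. Their
  inductive steps are the three axioms that relate the distributors to the multiplicative associator.
\<close>

lemma scale_scale:
  assumes "set m \<subseteq> Obj C" "set n \<subseteq> Obj C" "polynomial R"
  shows "scale_frame m (map ((@) n) R) \<cdot> (Id C (mon m) \<boxtimes> scale_frame n R) \<cdot> \<alpha>t (mon m) (mon n) (poly R) =
    scale_frame (m @ n) R \<cdot> (T.join m n \<boxtimes> Id C (poly R))"
  using assms
proof (induction R)
  case Nil
  then show ?case by (simp add: rnull_assoc null_nat)
next
  case (Cons k R)
  then have [simp]: "set m \<subseteq> Obj C" "set n \<subseteq> Obj C" "set k \<subseteq> Obj C" "polynomial R" by auto
  let ?m = "mon m" and ?n = "mon n" and ?k = "mon k" and ?r = "poly R"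
  let ?c = "T.join m (n @ k) \<boxplus> scale_frame m (map ((@) n) R)"
  have "scale_frame m (map ((@) n) (k # R)) \<cdot> (\<one>\<^sub>?m \<boxtimes> scale_frame n (k # R)) \<cdot> \<alpha>t ?m ?n (?k \<oplus> ?r) =
    ?c \<cdot> \<delta>l ?m (mon (n @ k)) (poly (map ((@) n) R)) \<cdot> (\<one>\<^sub>?m \<boxtimes> (T.join n k \<boxplus> scale_frame n R)) \<cdot>
      (\<one>\<^sub>?m \<boxtimes> \<delta>l ?n ?k ?r) \<cdot> \<alpha>t ?m ?n (?k \<oplus> ?r)"
    by simp
  also have "\<dots> = ?c \<cdot> ((\<one>\<^sub>?m \<boxtimes> T.join n k) \<boxplus> (\<one>\<^sub>?m \<boxtimes> scale_frame n R)) \<cdot>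
      \<delta>l ?m (?n \<otimes> ?k) (?n \<otimes> ?r) \<cdot> (\<one>\<^sub>?m \<boxtimes> \<delta>l ?n ?k ?r) \<cdot> \<alpha>t ?m ?n (?k \<oplus> ?r)"
    by (subst ldist_nat) simp_all
  also have "\<dots> = ?c \<cdot> ((\<one>\<^sub>?m \<boxtimes> T.join n k) \<boxplus> (\<one>\<^sub>?m \<boxtimes> scale_frame n R)) \<cdot>
      (\<alpha>t ?m ?n ?k \<boxplus> \<alpha>t ?m ?n ?r) \<cdot> \<delta>l (?m \<otimes> ?n) ?k ?r"
    by (subst ldist_mult_assoc) simp_all
  also have "\<dots> = ((T.join m (n @ k) \<cdot> (\<one>\<^sub>?m \<boxtimes> T.join n k) \<cdot> \<alpha>t ?m ?n ?k) \<boxplus>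
      (scale_frame m (map ((@) n) R) \<cdot> (\<one>\<^sub>?m \<boxtimes> scale_frame n R) \<cdot> \<alpha>t ?m ?n ?r)) \<cdot> \<delta>l (?m \<otimes> ?n) ?k ?r"
    by simp
  also have "\<dots> = ((T.join (m @ n) k \<cdot> (T.join m n \<boxtimes> \<one>\<^sub>?k)) \<boxplus> (scale_frame (m @ n) R \<cdot> (T.join m n \<boxtimes> \<one>\<^sub>?r))) \<cdot>
      \<delta>l (?m \<otimes> ?n) ?k ?r"
    by (subst Cons.IH) (simp_all add: T.join_assoc)
  also have "\<dots> = (T.join (m @ n) k \<boxplus> scale_frame (m @ n) R) \<cdot>
      (T.join m n \<boxtimes> \<one>\<^sub>?k \<boxplus> T.join m n \<boxtimes> \<one>\<^sub>?r) \<cdot> \<delta>l (?m \<otimes> ?n) ?k ?r"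
    by simp
  also have "\<dots> = (T.join (m @ n) k \<boxplus> scale_frame (m @ n) R) \<cdot>
      \<delta>l (mon (m @ n)) ?k ?r \<cdot> (T.join m n \<boxtimes> (\<one>\<^sub>?k \<boxplus> \<one>\<^sub>?r))"
    by (subst ldist_nat) simp_all
  finally show ?case by simp
qed

lemma mult_frame_scale:
  assumes "set m \<subseteq> Obj C" "polynomial Q" "polynomial R"
  shows "mult_frame (map ((@) m) Q) R \<cdot> (scale_frame m Q \<boxtimes> Id C (poly R)) =
    scale_frame m (poly_mult Q R) \<cdot> (Id C (mon m) \<boxtimes> mult_frame Q R) \<cdot> \<alpha>t (mon m) (poly Q) (poly R)"
  using assms
proof (induction Q)
  case Nil
  then show ?case by (simp add: lnull_rnull_assoc)
next
  case (Cons n Q)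
  then have [simp]: "set m \<subseteq> Obj C" "set n \<subseteq> Obj C" "polynomial Q" "polynomial R" by auto
  let ?m = "mon m" and ?n = "mon n" and ?q = "poly Q" and ?r = "poly R"
  let ?nR = "map ((@) n) R" and ?QR = "poly_mult Q R"
  let ?a = "add_frame (map ((@) m) ?nR) (map ((@) m) ?QR)"
  have "mult_frame (map ((@) m) (n # Q)) R \<cdot> (scale_frame m (n # Q) \<boxtimes> \<one>\<^sub>?r) =
    ?a \<cdot> (scale_frame (m @ n) R \<boxplus> mult_frame (map ((@) m) Q) R) \<cdot> \<delta>r (mon (m @ n)) (poly (map ((@) m) Q)) ?r \<cdot>
      ((T.join m n \<boxplus> scale_frame m Q) \<boxtimes> \<one>\<^sub>?r) \<cdot> (\<delta>l ?m ?n ?q \<boxtimes> \<one>\<^sub>?r)"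
    by (simp add: poly_mult_map_append)
  also have "\<dots> = ?a \<cdot> ((scale_frame (m @ n) R \<cdot> (T.join m n \<boxtimes> \<one>\<^sub>?r)) \<boxplus> (mult_frame (map ((@) m) Q) R \<cdot> (scale_frame m Q \<boxtimes> \<one>\<^sub>?r))) \<cdot>
      \<delta>r (?m \<otimes> ?n) (?m \<otimes> ?q) ?r \<cdot> (\<delta>l ?m ?n ?q \<boxtimes> \<one>\<^sub>?r)"
    by (subst rdist_nat) (simp_all add: poly_mult_map_append)
  also have "\<dots> = ?a \<cdot> ((scale_frame m ?nR \<cdot> (\<one>\<^sub>?m \<boxtimes> scale_frame n R) \<cdot> \<alpha>t ?m ?n ?r) \<boxplus>
      (scale_frame m ?QR \<cdot> (\<one>\<^sub>?m \<boxtimes> mult_frame Q R) \<cdot> \<alpha>t ?m ?q ?r)) \<cdot>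
      \<delta>r (?m \<otimes> ?n) (?m \<otimes> ?q) ?r \<cdot> (\<delta>l ?m ?n ?q \<boxtimes> \<one>\<^sub>?r)"
    by (subst Cons.IH, simp, simp, simp, subst scale_scale) simp_all
  also have "\<dots> = ?a \<cdot> (scale_frame m ?nR \<boxplus> scale_frame m ?QR) \<cdot> (\<one>\<^sub>?m \<boxtimes> scale_frame n R \<boxplus> \<one>\<^sub>?m \<boxtimes> mult_frame Q R) \<cdot>
      (\<alpha>t ?m ?n ?r \<boxplus> \<alpha>t ?m ?q ?r) \<cdot> \<delta>r (?m \<otimes> ?n) (?m \<otimes> ?q) ?r \<cdot> (\<delta>l ?m ?n ?q \<boxtimes> \<one>\<^sub>?r)"
    by simp
  also have "\<dots> = ?a \<cdot> (scale_frame m ?nR \<boxplus> scale_frame m ?QR) \<cdot> (\<one>\<^sub>?m \<boxtimes> scale_frame n R \<boxplus> \<one>\<^sub>?m \<boxtimes> mult_frame Q R) \<cdot>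
      \<delta>l ?m (?n \<otimes> ?r) (?q \<otimes> ?r) \<cdot> (\<one>\<^sub>?m \<boxtimes> \<delta>r ?n ?q ?r) \<cdot> \<alpha>t ?m (?n \<oplus> ?q) ?r"
    by (subst ldist_rdist_mult_assoc) simp_all
  also have "\<dots> = (?a \<cdot> (scale_frame m ?nR \<boxplus> scale_frame m ?QR) \<cdot> \<delta>l ?m (poly ?nR) (poly ?QR)) \<cdot>
      (\<one>\<^sub>?m \<boxtimes> (scale_frame n R \<boxplus> mult_frame Q R)) \<cdot> (\<one>\<^sub>?m \<boxtimes> \<delta>r ?n ?q ?r) \<cdot> \<alpha>t ?m (?n \<oplus> ?q) ?r"
    by (simp del: T.interchange) (subst ldist_nat, simp_all)
  also have "\<dots> = (scale_frame m (?nR @ ?QR) \<cdot> (\<one>\<^sub>?m \<boxtimes> add_frame ?nR ?QR)) \<cdot>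
      (\<one>\<^sub>?m \<boxtimes> (scale_frame n R \<boxplus> mult_frame Q R)) \<cdot> (\<one>\<^sub>?m \<boxtimes> \<delta>r ?n ?q ?r) \<cdot> \<alpha>t ?m (?n \<oplus> ?q) ?r"
    by (subst scale_add_frame) simp_all
  finally show ?case by simp
qed

lemma mult_frame_assoc:
  assumes "polynomial P" "polynomial Q" "polynomial R"
  shows "mult_frame (poly_mult P Q) R \<cdot> (mult_frame P Q \<boxtimes> Id C (poly R)) =
    mult_frame P (poly_mult Q R) \<cdot> (Id C (poly P) \<boxtimes> mult_frame Q R) \<cdot> \<alpha>t (poly P) (poly Q) (poly R)"
  using assms
proof (induction P)
  case Nil
  then have [simp]: "polynomial Q" "polynomial R" by auto
  have "l0 (poly R) \<cdot> (l0 (poly Q) \<boxtimes> Id C (poly R)) = l0 (poly Q \<otimes> poly R) \<cdot> \<alpha>t Z (poly Q) (poly R)"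
    by (simp add: lnull_assoc)
  also have "\<dots> = (l0 (poly (poly_mult Q R)) \<cdot> (\<one>\<^sub>Z \<boxtimes> mult_frame Q R)) \<cdot> \<alpha>t Z (poly Q) (poly R)"
    by (subst null_nat) simp_all
  finally show ?case by simp
next
  case (Cons m P)
  then have [simp]: "set m \<subseteq> Obj C" "polynomial P" "polynomial Q" "polynomial R" by auto
  let ?m = "mon m" and ?p = "poly P" and ?q = "poly Q" and ?r = "poly R"
  let ?mQ = "map ((@) m) Q" and ?PQ = "poly_mult P Q" and ?QR = "poly_mult Q R"
  let ?a = "add_frame (map ((@) m) ?QR) (poly_mult P ?QR)"
  have "mult_frame (poly_mult (m # P) Q) R \<cdot> (mult_frame (m # P) Q \<boxtimes> \<one>\<^sub>?r) =
    (mult_frame (?mQ @ ?PQ) R \<cdot> (add_frame ?mQ ?PQ \<boxtimes> \<one>\<^sub>?r)) \<cdot> ((scale_frame m Q \<boxplus> mult_frame P Q) \<boxtimes> \<one>\<^sub>?r) \<cdot> (\<delta>r ?m ?p ?q \<boxtimes> \<one>\<^sub>?r)"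
    by simp
  also have "\<dots> = ?a \<cdot> (mult_frame ?mQ R \<boxplus> mult_frame ?PQ R) \<cdot> \<delta>r (poly ?mQ) (poly ?PQ) ?r \<cdot>
      ((scale_frame m Q \<boxplus> mult_frame P Q) \<boxtimes> \<one>\<^sub>?r) \<cdot> (\<delta>r ?m ?p ?q \<boxtimes> \<one>\<^sub>?r)"
    by (subst mult_frame_add_frame) (simp_all add: poly_mult_map_append poly_mult_assoc)
  also have "\<dots> = ?a \<cdot> ((mult_frame ?mQ R \<cdot> (scale_frame m Q \<boxtimes> \<one>\<^sub>?r)) \<boxplus> (mult_frame ?PQ R \<cdot> (mult_frame P Q \<boxtimes> \<one>\<^sub>?r))) \<cdot>
      \<delta>r (?m \<otimes> ?q) (?p \<otimes> ?q) ?r \<cdot> (\<delta>r ?m ?p ?q \<boxtimes> \<one>\<^sub>?r)"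
    by (subst rdist_nat) (simp_all add: poly_mult_map_append poly_mult_assoc)
  also have "\<dots> = ?a \<cdot> ((scale_frame m ?QR \<cdot> (\<one>\<^sub>?m \<boxtimes> mult_frame Q R) \<cdot> \<alpha>t ?m ?q ?r) \<boxplus>
      (mult_frame P ?QR \<cdot> (\<one>\<^sub>?p \<boxtimes> mult_frame Q R) \<cdot> \<alpha>t ?p ?q ?r)) \<cdot>
      \<delta>r (?m \<otimes> ?q) (?p \<otimes> ?q) ?r \<cdot> (\<delta>r ?m ?p ?q \<boxtimes> \<one>\<^sub>?r)"
    by (subst Cons.IH, simp, simp, simp, subst mult_frame_scale) simp_all
  also have "\<dots> = ?a \<cdot> (scale_frame m ?QR \<boxplus> mult_frame P ?QR) \<cdot> (\<one>\<^sub>?m \<boxtimes> mult_frame Q R \<boxplus> \<one>\<^sub>?p \<boxtimes> mult_frame Q R) \<cdot>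
      (\<alpha>t ?m ?q ?r \<boxplus> \<alpha>t ?p ?q ?r) \<cdot> \<delta>r (?m \<otimes> ?q) (?p \<otimes> ?q) ?r \<cdot> (\<delta>r ?m ?p ?q \<boxtimes> \<one>\<^sub>?r)"
    by simp
  also have "\<dots> = ?a \<cdot> (scale_frame m ?QR \<boxplus> mult_frame P ?QR) \<cdot> (\<one>\<^sub>?m \<boxtimes> mult_frame Q R \<boxplus> \<one>\<^sub>?p \<boxtimes> mult_frame Q R) \<cdot>
      \<delta>r ?m ?p (?q \<otimes> ?r) \<cdot> \<alpha>t (?m \<oplus> ?p) ?q ?r"
    by (subst rdist_mult_assoc) simp_all
  also have "\<dots> = ?a \<cdot> (scale_frame m ?QR \<boxplus> mult_frame P ?QR) \<cdot> \<delta>r ?m ?p (poly ?QR) \<cdot>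
      ((\<one>\<^sub>?m \<boxplus> \<one>\<^sub>?p) \<boxtimes> mult_frame Q R) \<cdot> \<alpha>t (?m \<oplus> ?p) ?q ?r"
    by (subst rdist_nat) simp_all
  finally show ?case by simp
qed

lemma scale_Nil: "polynomial Q \<Longrightarrow> scale_frame [] Q = lt (poly Q)"
  by (induction Q) (simp_all add: lunit_rnull ldist_mult_lunit)

lemma mult_frame_Nil: "polynomial P \<Longrightarrow> mult_frame P [] = r0 (poly P)"
  by (induction P) (simp_all add: null_null rnull_rdist)

text \<open>
  The unit polynomial consists of one empty monomial, whose value is \<open>U \<oplus> Z\<close> and not \<open>U\<close>; the inverse of
  the additive right unit isomorphism is its frame.
\<close>

lemma mult_frame_lunit:
  assumes [simp]: "polynomial Q"
  shows "mult_frame [[]] Q \<cdot> (inverse_arrow C (rp U) \<boxtimes> Id C (poly Q)) = lt (poly Q)"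
proof -
  let ?q = "poly Q"
  have "mult_frame [[]] Q = (rp ?q \<cdot> (lt ?q \<boxplus> \<one>\<^sub>Z)) \<cdot> (Id C (U \<otimes> ?q) \<boxplus> l0 ?q) \<cdot> \<delta>r U Z ?q"
    by (simp add: add_frame_Nil scale_Nil)
  also have "\<dots> = lt ?q \<cdot> rp (U \<otimes> ?q) \<cdot> (Id C (U \<otimes> ?q) \<boxplus> l0 ?q) \<cdot> \<delta>r U Z ?q"
    by (subst P.runit_nat) simp_all
  also have "\<dots> = lt ?q \<cdot> (rp U \<boxtimes> \<one>\<^sub>?q)"
    by (subst rdist_add_runit) simp_all
  finally show ?thesis by simp
qed

lemma mult_frame_runit:
  assumes "polynomial P"
  shows "mult_frame P [[]] \<cdot> (Id C (poly P) \<boxtimes> inverse_arrow C (rp U)) = rt (poly P)"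
  using assms
proof (induction P)
  case Nil
  show ?case by (simp add: null_nat runit_lnull)
next
  case (Cons m P)
  then have [simp]: "set m \<subseteq> Obj C" "polynomial P" by auto
  let ?m = "mon m" and ?p = "poly P" and ?i = "inverse_arrow C (rp U)"
  have "scale_frame m [[]] = (rt ?m \<boxplus> r0 ?m) \<cdot> \<delta>l ?m U Z"
    by (simp add: T.join_Nil)
  then have "rp ?m \<cdot> scale_frame m [[]] = (rp ?m \<cdot> (rt ?m \<boxplus> \<one>\<^sub>Z)) \<cdot> (Id C (?m \<otimes> U) \<boxplus> r0 ?m) \<cdot> \<delta>l ?m U Z"
    by simp
  also have "\<dots> = rt ?m \<cdot> rp (?m \<otimes> U) \<cdot> (Id C (?m \<otimes> U) \<boxplus> r0 ?m) \<cdot> \<delta>l ?m U Z"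
    by (subst P.runit_nat) simp_all
  also have "\<dots> = rt ?m \<cdot> (\<one>\<^sub>?m \<boxtimes> rp U)"
    by (subst ldist_add_runit) simp_all
  finally have s: "rp ?m \<cdot> scale_frame m [[]] = rt ?m \<cdot> (\<one>\<^sub>?m \<boxtimes> rp U)" .
  have t: "rp ?m \<cdot> scale_frame m [[]] \<cdot> (\<one>\<^sub>?m \<boxtimes> ?i) = (rp ?m \<cdot> scale_frame m [[]]) \<cdot> (\<one>\<^sub>?m \<boxtimes> ?i)"
    by simp
  have "mult_frame (m # P) [[]] \<cdot> (Id C (?m \<oplus> ?p) \<boxtimes> ?i) =
    ((\<one>\<^sub>?m \<boxplus> lp ?p) \<cdot> \<alpha>p ?m Z ?p) \<cdot> (scale_frame m [[]] \<boxplus> mult_frame P [[]]) \<cdot> \<delta>r ?m ?p (U \<oplus> Z) \<cdot> ((\<one>\<^sub>?m \<boxplus> \<one>\<^sub>?p) \<boxtimes> ?i)"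
    by simp
  also have "\<dots> = (rp ?m \<boxplus> \<one>\<^sub>?p) \<cdot> (scale_frame m [[]] \<boxplus> mult_frame P [[]]) \<cdot> (\<one>\<^sub>?m \<boxtimes> ?i \<boxplus> \<one>\<^sub>?p \<boxtimes> ?i) \<cdot> \<delta>r ?m ?p U"
    by (subst P.triangle, simp, simp, subst rdist_nat) simp_all
  also have "\<dots> = ((rp ?m \<cdot> scale_frame m [[]] \<cdot> (\<one>\<^sub>?m \<boxtimes> ?i)) \<boxplus> (mult_frame P [[]] \<cdot> (\<one>\<^sub>?p \<boxtimes> ?i))) \<cdot> \<delta>r ?m ?p U"
    by simp
  also have "\<dots> = (rt ?m \<boxplus> rt ?p) \<cdot> \<delta>r ?m ?p U"
    by (subst Cons.IH, simp, unfold t s) simp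
  finally show ?case by (simp add: rdist_mult_runit)
qed

end

section \<open>Transport of the structure along frames\<close>

sublocale braided_bimonoidal_category \<subseteq> B: braided_monoidal_category C "mult C" "mult_braid C"
  by (rule mult_braided)

context braided_monoidal_category begin

lemma braid_typing [simp]:
  assumes "A \<in> Obj C" "B \<in> Obj C"
  shows "\<zeta> A B \<in> Arr C" "Dom C (\<zeta> A B) = tensor M A B" "Cod C (\<zeta> A B) = tensor M B A"
  using braid_hom[OF assms] by auto

declare braid_iso [simp]

lemma braid_nat:
  assumes "f \<in> Arr C" "g \<in> Arr C" "Cod C f = A" "Cod C g = B"
  shows "\<zeta> A B \<cdot> tensor_arr M f g = tensor_arr M g f \<cdot> \<zeta> (Dom C f) (Dom C g)"
  using braid_natural assms by auto

end

text \<open>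
  The data of a transport: a set \<open>X\<close> of new objects with values in \<open>C\<close>, operations on them, frames that
  compare these operations with those of \<open>C\<close>, and for each object of \<open>C\<close> a new object with isomorphic value.
\<close>

locale transport = tight_braided_bimonoidal_category C
  for C :: "('o, 'm, 'x) braided_bimon_data_scheme" +
  fixes X :: "'p set" and ev :: "'p \<Rightarrow> 'o"
    and pl tm :: "'p \<Rightarrow> 'p \<Rightarrow> 'p" and ze un :: 'p
    and \<phi>p \<phi>t :: "'p \<Rightarrow> 'p \<Rightarrow> 'm" and \<phi>0 \<phi>1 :: 'm
    and g :: "'o \<Rightarrow> 'p" and \<kappa> :: "'o \<Rightarrow> 'm"
  assumes ev_Obj [simp]: "P \<in> X \<Longrightarrow> ev P \<in> Obj C"
    and pl_X [simp]: "P \<in> X \<Longrightarrow> Q \<in> X \<Longrightarrow> pl P Q \<in> X"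
    and tm_X [simp]: "P \<in> X \<Longrightarrow> Q \<in> X \<Longrightarrow> tm P Q \<in> X"
    and ze_X [simp]: "ze \<in> X" and un_X [simp]: "un \<in> X"
    and \<phi>p_frame: "P \<in> X \<Longrightarrow> Q \<in> X \<Longrightarrow>
      iso C (\<phi>p P Q) \<and> Dom C (\<phi>p P Q) = ev P \<oplus> ev Q \<and> Cod C (\<phi>p P Q) = ev (pl P Q)"
    and \<phi>t_frame: "P \<in> X \<Longrightarrow> Q \<in> X \<Longrightarrow>
      iso C (\<phi>t P Q) \<and> Dom C (\<phi>t P Q) = ev P \<otimes> ev Q \<and> Cod C (\<phi>t P Q) = ev (tm P Q)"
    and \<phi>0_frame: "iso C \<phi>0 \<and> Dom C \<phi>0 = Z \<and> Cod C \<phi>0 = ev ze"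
    and \<phi>1_frame: "iso C \<phi>1 \<and> Dom C \<phi>1 = U \<and> Cod C \<phi>1 = ev un"
    and g_X [simp]: "A \<in> Obj C \<Longrightarrow> g A \<in> X"
    and \<kappa>_frame: "A \<in> Obj C \<Longrightarrow> iso C (\<kappa> A) \<and> Dom C (\<kappa> A) = A \<and> Cod C (\<kappa> A) = ev (g A)"
begin

lemma \<phi>_typing [simp]:
  "P \<in> X \<Longrightarrow> Q \<in> X \<Longrightarrow> iso C (\<phi>p P Q)" "P \<in> X \<Longrightarrow> Q \<in> X \<Longrightarrow> \<phi>p P Q \<in> Arr C"
  "P \<in> X \<Longrightarrow> Q \<in> X \<Longrightarrow> Dom C (\<phi>p P Q) = ev P \<oplus> ev Q"
  "P \<in> X \<Longrightarrow> Q \<in> X \<Longrightarrow> Cod C (\<phi>p P Q) = ev (pl P Q)"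
  "P \<in> X \<Longrightarrow> Q \<in> X \<Longrightarrow> iso C (\<phi>t P Q)" "P \<in> X \<Longrightarrow> Q \<in> X \<Longrightarrow> \<phi>t P Q \<in> Arr C"
  "P \<in> X \<Longrightarrow> Q \<in> X \<Longrightarrow> Dom C (\<phi>t P Q) = ev P \<otimes> ev Q"
  "P \<in> X \<Longrightarrow> Q \<in> X \<Longrightarrow> Cod C (\<phi>t P Q) = ev (tm P Q)"
  "iso C \<phi>0" "\<phi>0 \<in> Arr C" "Dom C \<phi>0 = Z" "Cod C \<phi>0 = ev ze"
  "iso C \<phi>1" "\<phi>1 \<in> Arr C" "Dom C \<phi>1 = U" "Cod C \<phi>1 = ev un"
  "A \<in> Obj C \<Longrightarrow> iso C (\<kappa> A)" "A \<in> Obj C \<Longrightarrow> \<kappa> A \<in> Arr C"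
  "A \<in> Obj C \<Longrightarrow> Dom C (\<kappa> A) = A" "A \<in> Obj C \<Longrightarrow> Cod C (\<kappa> A) = ev (g A)"
  using \<phi>p_frame \<phi>t_frame \<phi>0_frame \<phi>1_frame \<kappa>_frame P.iso_typing(1) by auto

text \<open>
  All canonical isomorphisms are indexed by formal expressions whose atoms are new objects or objects of
  \<open>C\<close>. Such an expression has a value in \<open>C\<close>, a new object obtained by performing the operations on the new
  objects, and a frame from the former to the value of the latter. Atoms from \<open>C\<close> make the structure maps of the functor
  from \<open>C\<close> instances of the same construction.
\<close>

primrec val :: "('p + 'o) rig_expr \<Rightarrow> 'o" where
  "val (Gen x) = (case x of Inl P \<Rightarrow> ev P | Inr A \<Rightarrow> A)"
| "val Zero = Z" | "val One = U"
| "val (Plus a b) = val a \<oplus> val b" | "val (Times a b) = val a \<otimes> val b"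

primrec nf :: "('p + 'o) rig_expr \<Rightarrow> 'p" where
  nf_Gen: "nf (Gen x) = (case x of Inl P \<Rightarrow> P | Inr A \<Rightarrow> g A)"
| nf_Zero: "nf Zero = ze" | nf_One: "nf One = un"
| nf_Plus: "nf (Plus a b) = pl (nf a) (nf b)" | nf_Times: "nf (Times a b) = tm (nf a) (nf b)"

primrec wf :: "('p + 'o) rig_expr \<Rightarrow> bool" where
  "wf (Gen x) \<longleftrightarrow> (case x of Inl P \<Rightarrow> P \<in> X | Inr A \<Rightarrow> A \<in> Obj C)"
| "wf Zero \<longleftrightarrow> True" | "wf One \<longleftrightarrow> True"
| "wf (Plus a b) \<longleftrightarrow> wf a \<and> wf b" | "wf (Times a b) \<longleftrightarrow> wf a \<and> wf b"

primrec frame :: "('p + 'o) rig_expr \<Rightarrow> 'm" where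
  frame_Gen: "frame (Gen x) = (case x of Inl P \<Rightarrow> Id C (ev P) | Inr A \<Rightarrow> \<kappa> A)"
| frame_Zero: "frame Zero = \<phi>0" | frame_One: "frame One = \<phi>1"
| frame_Plus: "frame (Plus a b) = \<phi>p (nf a) (nf b) \<cdot> (frame a \<boxplus> frame b)"
| frame_Times: "frame (Times a b) = \<phi>t (nf a) (nf b) \<cdot> (frame a \<boxtimes> frame b)"

lemmas nf_eqs = nf.simps
lemmas frame_eqs = frame.simps

declare nf.simps [simp del] frame.simps [simp del]

lemma val_Obj [simp]: "wf e \<Longrightarrow> val e \<in> Obj C"
  by (induction e) (auto split: sum.splits)

lemma nf_X [simp]: "wf e \<Longrightarrow> nf e \<in> X"
  by (induction e) (auto simp: nf_eqs split: sum.splits)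

lemma frame_iso_typing: "wf e \<Longrightarrow> iso C (frame e) \<and> Dom C (frame e) = val e \<and> Cod C (frame e) = ev (nf e)"
  by (induction e) (auto simp: nf_eqs frame_eqs split: sum.splits)

lemma frame_typing [simp]:
  assumes "wf e"
  shows "iso C (frame e)" "frame e \<in> Arr C" "Dom C (frame e) = val e" "Cod C (frame e) = ev (nf e)"
  using frame_iso_typing[OF assms] P.iso_typing(1) by auto

abbreviation L :: "'p \<Rightarrow> ('p + 'o) rig_expr" where "L P \<equiv> Gen (Inl P)"
abbreviation R :: "'o \<Rightarrow> ('p + 'o) rig_expr" where "R A \<equiv> Gen (Inr A)"

text \<open>
  An arrow between the values of two expressions, conjugated by their frames. The assignment preserves
  composition and all structure maps (the \<open>fold\<close> lemmas below), so an equation between composites in the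
  new category turns into the same equation in \<open>C\<close>.
\<close>

definition N :: "('p + 'o) rig_expr \<Rightarrow> 'm \<Rightarrow> ('p + 'o) rig_expr \<Rightarrow> 'p \<times> 'm \<times> 'p" where
  "N e m e' = (nf e, frame e' \<cdot> m \<cdot> inverse_arrow C (frame e), nf e')"

definition S :: "('p, 'p \<times> 'm \<times> 'p) braided_bimon_data" where
  "S = \<lparr>
    Obj = X,
    Arr = {(P, f, Q). P \<in> X \<and> Q \<in> X \<and> f \<in> Arr C \<and> Dom C f = ev P \<and> Cod C f = ev Q},
    Dom = fst,
    Cod = (\<lambda>f. snd (snd f)),
    Id = (\<lambda>P. (P, Id C (ev P), P)),
    Comp = (\<lambda>h f. (fst f, fst (snd h) \<cdot> fst (snd f), snd (snd h))),
    add = \<lparr>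
      tensor = pl,
      tensor_arr = (\<lambda>f h. N (Plus (L (fst f)) (L (fst h))) (fst (snd f) \<boxplus> fst (snd h))
        (Plus (L (snd (snd f))) (L (snd (snd h))))),
      unit_obj = ze,
      assoc = (\<lambda>P Q R. N (Plus (Plus (L P) (L Q)) (L R)) (\<alpha>p (ev P) (ev Q) (ev R))
        (Plus (L P) (Plus (L Q) (L R)))),
      lunit = (\<lambda>P. N (Plus Zero (L P)) (lp (ev P)) (L P)),
      runit = (\<lambda>P. N (Plus (L P) Zero) (rp (ev P)) (L P)) \<rparr>,
    add_sym = (\<lambda>P Q. N (Plus (L P) (L Q)) (\<zeta>p (ev P) (ev Q)) (Plus (L Q) (L P))),
    mult = \<lparr>
      tensor = tm,
      tensor_arr = (\<lambda>f h. N (Times (L (fst f)) (L (fst h))) (fst (snd f) \<boxtimes> fst (snd h))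
        (Times (L (snd (snd f))) (L (snd (snd h))))),
      unit_obj = un,
      assoc = (\<lambda>P Q R. N (Times (Times (L P) (L Q)) (L R)) (\<alpha>t (ev P) (ev Q) (ev R))
        (Times (L P) (Times (L Q) (L R)))),
      lunit = (\<lambda>P. N (Times One (L P)) (lt (ev P)) (L P)),
      runit = (\<lambda>P. N (Times (L P) One) (rt (ev P)) (L P)) \<rparr>,
    lnull = (\<lambda>P. N (Times Zero (L P)) (l0 (ev P)) Zero),
    rnull = (\<lambda>P. N (Times (L P) Zero) (r0 (ev P)) Zero),
    ldist = (\<lambda>P Q R. N (Times (L P) (Plus (L Q) (L R))) (\<delta>l (ev P) (ev Q) (ev R))
      (Plus (Times (L P) (L Q)) (Times (L P) (L R)))),
    rdist = (\<lambda>P Q R. N (Times (Plus (L P) (L Q)) (L R)) (\<delta>r (ev P) (ev Q) (ev R))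
      (Plus (Times (L P) (L R)) (Times (L Q) (L R)))),
    mult_braid = (\<lambda>P Q. N (Times (L P) (L Q)) (mult_braid C (ev P) (ev Q)) (Times (L Q) (L P))) \<rparr>"

lemma category_S: "category S"
  by unfold_locales (auto simp: S_def hom_def)

lemma Obj_S: "Obj S = X" by (simp add: S_def)

text \<open>
  Different expressions may denote the same new object, and the structure maps of \<open>S\<close> are defined by expressions
  with atomic arguments. Replacing an atom by a compound expression changes the frame by an arrow
  of \<open>C\<close>, and naturality of the structure maps compensates for it.
\<close>

lemma N_change:
  assumes "nf e = nf d" "nf e' = nf d'" "frame e = frame d \<cdot> s" "frame e' = frame d' \<cdot> t" "wf e" "wf e'" "wf d" "wf d'"
    and "iso C s" "Dom C s = val e" "Cod C s = val d" "t \<in> Arr C" "Dom C t = val e'" "Cod C t = val d'"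
    and "m \<in> Arr C" "Dom C m = val e" "Cod C m = val e'" "m' \<in> Arr C" "Dom C m' = val d" "Cod C m' = val d'"
    and "m' \<cdot> s = t \<cdot> m"
  shows "N d m' d' = N e m e'"
proof -
  have "frame d' \<cdot> t \<cdot> m \<cdot> inverse_arrow C s \<cdot> inverse_arrow C (frame d) =
    frame d' \<cdot> (t \<cdot> m) \<cdot> inverse_arrow C s \<cdot> inverse_arrow C (frame d)"
    using assms(5-20) by simp
  also have "\<dots> = frame d' \<cdot> m' \<cdot> inverse_arrow C (frame d)"
    unfolding assms(21)[symmetric] using assms(5-20) by simp
  finally show ?thesis
    using assms(5-20) by (simp add: N_def assms(1-4))
qed

lemma N_Arr [simp]:
  assumes "wf e" "wf e'" "m \<in> Arr C" "Dom C m = val e" "Cod C m = val e'"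
  shows "N e m e' \<in> Arr S" "Dom S (N e m e') = nf e" "Cod S (N e m e') = nf e'"
  using assms by (simp_all add: N_def S_def)

lemma N_inj [simp]:
  assumes "wf e" "wf e'" "m \<in> Arr C" "Dom C m = val e" "Cod C m = val e'"
    "m' \<in> Arr C" "Dom C m' = val e" "Cod C m' = val e'"
  shows "N e m e' = N e m' e' \<longleftrightarrow> m = m'"
proof
  assume "N e m e' = N e m' e'"
  then have "frame e' \<cdot> m \<cdot> inverse_arrow C (frame e) = frame e' \<cdot> m' \<cdot> inverse_arrow C (frame e)"
    by (simp add: N_def)
  then have "m \<cdot> inverse_arrow C (frame e) = m' \<cdot> inverse_arrow C (frame e)"
    by (rule P.iso_cancel_left[rotated 5]) (use assms in simp_all)
  then show "m = m'"
    by (rule P.iso_cancel_right[rotated 5]) (use assms in simp_all)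
qed simp

lemma fold_Comp:
  assumes "wf e1" "wf e2" "wf e3" "f \<in> Arr C" "h \<in> Arr C"
    "Dom C f = val e1" "Cod C f = val e2" "Dom C h = val e2" "Cod C h = val e3"
  shows "Comp S (N e2 h e3) (N e1 f e2) = N e1 (h \<cdot> f) e3"
  using assms by (simp add: N_def S_def)

lemma fold_Id: "wf e \<Longrightarrow> Id S (nf e) = N e (Id C (val e)) e"
  by (simp add: N_def S_def)

lemma fold_Obj:
  "tensor (add S) (nf a) (nf b) = nf (Plus a b)" "unit_obj (add S) = nf Zero"
  "tensor (mult S) (nf a) (nf b) = nf (Times a b)" "unit_obj (mult S) = nf One"
  by (simp_all add: S_def nf_eqs)

lemma N_frames: "fst (N e m e') = nf e" "snd (snd (N e m e')) = nf e'"
  "fst (snd (N e m e')) = frame e' \<cdot> m \<cdot> inverse_arrow C (frame e)"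
  by (simp_all add: N_def)

lemma fold_tensor:
  assumes [simp]: "wf a" "wf a'" "wf b" "wf b'" "f \<in> Arr C" "h \<in> Arr C"
    "Dom C f = val a" "Cod C f = val a'" "Dom C h = val b" "Cod C h = val b'"
  shows "tensor_arr (add S) (N a f a') (N b h b') = N (Plus a b) (f \<boxplus> h) (Plus a' b')"
    and "tensor_arr (mult S) (N a f a') (N b h b') = N (Times a b) (f \<boxtimes> h) (Times a' b')"
  by (simp_all add: S_def N_frames) (simp_all add: N_def nf_eqs frame_eqs)

lemma fold_assoc:
  assumes [simp]: "wf a" "wf b" "wf c"
  shows "assoc (add S) (nf a) (nf b) (nf c) =
      N (Plus (Plus a b) c) (\<alpha>p (val a) (val b) (val c)) (Plus a (Plus b c))"
    and "assoc (mult S) (nf a) (nf b) (nf c) =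
      N (Times (Times a b) c) (\<alpha>t (val a) (val b) (val c)) (Times a (Times b c))"
   apply (simp_all add: S_def)
   apply (rule N_change[where s = "(frame a \<boxplus> frame b) \<boxplus> frame c" and t = "frame a \<boxplus> (frame b \<boxplus> frame c)"];
      simp add: nf_eqs frame_eqs P.assoc_nat)
  apply (rule N_change[where s = "(frame a \<boxtimes> frame b) \<boxtimes> frame c" and t = "frame a \<boxtimes> (frame b \<boxtimes> frame c)"];
      simp add: nf_eqs frame_eqs T.assoc_nat)
  done

lemma fold_unit:
  assumes [simp]: "wf a"
  shows "lunit (add S) (nf a) = N (Plus Zero a) (lp (val a)) a"
    "runit (add S) (nf a) = N (Plus a Zero) (rp (val a)) a"
    "lunit (mult S) (nf a) = N (Times One a) (lt (val a)) a"
    "runit (mult S) (nf a) = N (Times a One) (rt (val a)) a"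
     apply (simp_all add: S_def)
     apply (rule N_change[where s = "\<one>\<^sub>Z \<boxplus> frame a" and t = "frame a"]; simp add: nf_eqs frame_eqs P.lunit_nat)
    apply (rule N_change[where s = "frame a \<boxplus> \<one>\<^sub>Z" and t = "frame a"]; simp add: nf_eqs frame_eqs P.runit_nat)
   apply (rule N_change[where s = "\<one>\<^sub>U \<boxtimes> frame a" and t = "frame a"]; simp add: nf_eqs frame_eqs T.lunit_nat)
  apply (rule N_change[where s = "frame a \<boxtimes> \<one>\<^sub>U" and t = "frame a"]; simp add: nf_eqs frame_eqs T.runit_nat)
  done

lemma fold_braid:
  assumes [simp]: "wf a" "wf b"
  shows "add_sym S (nf a) (nf b) = N (Plus a b) (\<zeta>p (val a) (val b)) (Plus b a)"
    "mult_braid S (nf a) (nf b) = N (Times a b) (mult_braid C (val a) (val b)) (Times b a)"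
   apply (simp_all add: S_def)
   apply (rule N_change[where s = "frame a \<boxplus> frame b" and t = "frame b \<boxplus> frame a"]; simp add: nf_eqs frame_eqs P.braid_nat)
  apply (rule N_change[where s = "frame a \<boxtimes> frame b" and t = "frame b \<boxtimes> frame a"]; simp add: nf_eqs frame_eqs B.braid_nat)
  done

lemma fold_null:
  assumes [simp]: "wf a"
  shows "lnull S (nf a) = N (Times Zero a) (l0 (val a)) Zero"
    "rnull S (nf a) = N (Times a Zero) (r0 (val a)) Zero"
   apply (simp_all add: S_def)
   apply (rule N_change[where s = "\<one>\<^sub>Z \<boxtimes> frame a" and t = "\<one>\<^sub>Z"]; simp add: nf_eqs frame_eqs null_nat)
  apply (rule N_change[where s = "frame a \<boxtimes> \<one>\<^sub>Z" and t = "\<one>\<^sub>Z"]; simp add: nf_eqs frame_eqs null_nat)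
  done

lemma fold_dist:
  assumes [simp]: "wf a" "wf b" "wf c"
  shows "ldist S (nf a) (nf b) (nf c) =
      N (Times a (Plus b c)) (\<delta>l (val a) (val b) (val c)) (Plus (Times a b) (Times a c))"
    "rdist S (nf a) (nf b) (nf c) =
      N (Times (Plus a b) c) (\<delta>r (val a) (val b) (val c)) (Plus (Times a c) (Times b c))"
   apply (simp_all add: S_def)
   apply (rule N_change[where s = "frame a \<boxtimes> (frame b \<boxplus> frame c)" and t = "frame a \<boxtimes> frame b \<boxplus> frame a \<boxtimes> frame c"];
      simp add: nf_eqs frame_eqs ldist_nat)
  apply (rule N_change[where s = "(frame a \<boxplus> frame b) \<boxtimes> frame c" and t = "frame a \<boxtimes> frame c \<boxplus> frame b \<boxtimes> frame c"];
      simp add: nf_eqs frame_eqs rdist_nat)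
  done

lemma inverse_arrows_N:
  assumes [simp]: "wf e" "wf e'" "iso C m" "Dom C m = val e" "Cod C m = val e'"
  shows "inverse_arrows S (N e m e') (N e' (inverse_arrow C m) e)"
  by (simp add: inverse_arrows_def hom_def fold_Comp fold_Id)

lemma iso_N [simp]:
  assumes "wf e" "wf e'" "iso C m" "Dom C m = val e" "Cod C m = val e'"
  shows "iso S (N e m e')"
  unfolding iso_def[of S] using inverse_arrows_N[OF assms] by blast

lemma fold_inverse:
  assumes "wf e" "wf e'" "iso C m" "Dom C m = val e" "Cod C m = val e'"
  shows "inverse_arrow S (N e m e') = N e' (inverse_arrow C m) e"
  by (rule category.inverse_arrowI[OF category_S]) (rule inverse_arrows_N[OF assms])

lemmas folds = fold_Comp fold_Id fold_Obj fold_tensor fold_assoc fold_unit fold_braid fold_null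
  fold_dist fold_inverse Obj_S hom_def[of S]

lemma \<mu>_typing [simp]:
  assumes "A \<in> Obj C" "B \<in> Obj C" "D \<in> Obj C" "E \<in> Obj C"
  shows "\<mu> A B D E \<in> Arr C" "Dom C (\<mu> A B D E) = (A \<oplus> B) \<oplus> (D \<oplus> E)"
    "Cod C (\<mu> A B D E) = (A \<oplus> D) \<oplus> (B \<oplus> E)"
  using assms by (simp_all add: \<mu>_def)

lemma fold_\<mu>:
  assumes "wf a" "wf b" "wf c" "wf d"
  shows "bimonoidal_syntax.\<mu> S (nf a) (nf b) (nf c) (nf d) =
    N (Plus (Plus a b) (Plus c d)) (\<mu> (val a) (val b) (val c) (val d)) (Plus (Plus a c) (Plus b d))"
  using assms by (simp add: folds bimonoidal_syntax.\<mu>_def[of S] \<mu>_def)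

lemma ObjE:
  assumes "P \<in> Obj S"
  obtains a where "P = nf a" "wf a"
  using assms that[of "L P"] by (simp add: nf_eqs Obj_S)

lemma hom_nfE:
  assumes "f \<in> hom S (nf a) (nf b)" "wf a" "wf b"
  obtains m where "f = N a m b" "m \<in> Arr C" "Dom C m = val a" "Cod C m = val b"
proof -
  obtain k where k: "f = (nf a, k, nf b)" "k \<in> Arr C" "Dom C k = ev (nf a)" "Cod C k = ev (nf b)"
    using assms(1) by (cases f) (auto simp: hom_def S_def)
  show thesis
    by (rule that[of "inverse_arrow C (frame b) \<cdot> k \<cdot> frame a"]) (use k assms(2,3) in \<open>simp_all add: N_def\<close>)
qed

lemma homE:
  assumes "f \<in> hom S P Q"
  obtains a b m where "P = nf a" "Q = nf b" "wf a" "wf b" "f = N a m b" "m \<in> Arr C"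
    "Dom C m = val a" "Cod C m = val b"
proof -
  have "P \<in> Obj S" "Q \<in> Obj S"
    using assms by (cases f; auto simp: hom_def S_def)+
  then obtain a b where "P = nf a" "Q = nf b" "wf a" "wf b" by (elim ObjE)
  with assms that show thesis by (metis hom_nfE)
qed

lemma mono_N [simp]:
  assumes "wf e" "wf e'" "iso C m" "Dom C m = val e" "Cod C m = val e'"
  shows "mono_arrow S (N e m e')"
  by (rule category.iso_mono[OF category_S]) (rule iso_N[OF assms])

text \<open>
  Two arrows that meet in an object must be presented with the same expression for that object before
  their composite can be computed in \<open>C\<close>.
\<close>

lemma tensor_Comp_S:
  assumes "f \<in> hom S P P'" "f' \<in> hom S P' P''" "h \<in> hom S Q Q'" "h' \<in> hom S Q' Q''"
  shows "tensor_arr (add S) (Comp S f' f) (Comp S h' h) =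
      Comp S (tensor_arr (add S) f' h') (tensor_arr (add S) f h)"
    and "tensor_arr (mult S) (Comp S f' f) (Comp S h' h) =
      Comp S (tensor_arr (mult S) f' h') (tensor_arr (mult S) f h)"
proof -
  obtain a a' m where 1: "P = nf a" "P' = nf a'" "wf a" "wf a'" "f = N a m a'" "m \<in> Arr C"
    "Dom C m = val a" "Cod C m = val a'" by (rule homE[OF assms(1)])
  obtain b b' n where 2: "Q = nf b" "Q' = nf b'" "wf b" "wf b'" "h = N b n b'" "n \<in> Arr C"
    "Dom C n = val b" "Cod C n = val b'" by (rule homE[OF assms(3)])
  have "P'' \<in> Obj S" "Q'' \<in> Obj S"
    using assms(2,4) by (auto simp: hom_def intro: category.Cod_Obj[OF category_S])
  then obtain a'' b'' where 3: "P'' = nf a''" "wf a''" "Q'' = nf b''" "wf b''"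
    by (elim ObjE)
  obtain m' where 4: "f' = N a' m' a''" "m' \<in> Arr C" "Dom C m' = val a'" "Cod C m' = val a''"
    using assms(2) 1 3 by (auto elim: hom_nfE)
  obtain n' where 5: "h' = N b' n' b''" "n' \<in> Arr C" "Dom C n' = val b'" "Cod C n' = val b''"
    using assms(4) 2 3 by (auto elim: hom_nfE)
  show "tensor_arr (add S) (Comp S f' f) (Comp S h' h) =
      Comp S (tensor_arr (add S) f' h') (tensor_arr (add S) f h)"
    and "tensor_arr (mult S) (Comp S f' f) (Comp S h' h) =
      Comp S (tensor_arr (mult S) f' h') (tensor_arr (mult S) f h)"
    using 1 2 3 4 5 by (simp_all add: folds)
qed

section \<open>The transported bimonoidal category\<close>

text \<open>
  Every object is the normal form of an expression and every arrow comes from \<open>C\<close>, so each axiom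
  for \<open>S\<close> is rewritten by the \<open>fold\<close> lemmas into the corresponding axiom for \<open>C\<close>.
\<close>

lemma monoidal_add_S: "monoidal_category S (add S)"
  apply (intro monoidal_category.intro monoidal_category_axioms.intro category_S;
      (rule tensor_Comp_S(1); assumption)?; (elim ObjE homE)?; hypsubst?)
  by (simp_all add: folds P.assoc_nat P.lunit_nat P.runit_nat P.triangle P.pentagon)

lemma monoidal_mult_S: "monoidal_category S (mult S)"
  apply (intro monoidal_category.intro monoidal_category_axioms.intro category_S;
      (rule tensor_Comp_S(2); assumption)?; (elim ObjE homE)?; hypsubst?)
  by (simp_all add: folds T.assoc_nat T.lunit_nat T.runit_nat T.triangle T.pentagon)

lemma symmetric_add_S: "symmetric_monoidal_category S (add S) (add_sym S)"
  apply (intro symmetric_monoidal_category.intro symmetric_monoidal_category_axioms.intro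
      braided_monoidal_category.intro braided_monoidal_category_axioms.intro monoidal_add_S;
      (elim ObjE homE)?; hypsubst?)
  by (simp_all add: folds P.braid_nat P.hexagon1 P.hexagon2 P.symmetry)

lemma braided_mult_S: "braided_monoidal_category S (mult S) (mult_braid S)"
  apply (intro braided_monoidal_category.intro braided_monoidal_category_axioms.intro monoidal_mult_S;
      (elim ObjE homE)?; hypsubst?)
  by (simp_all add: folds B.braid_nat B.hexagon1 B.hexagon2)

lemma bimonoidal_S: "bimonoidal_category S"
  apply (intro bimonoidal_category.intro symmetric_add_S monoidal_mult_S;
      (elim ObjE homE)?; hypsubst?)
  by (simp_all add: folds fold_\<mu> ldist_rdist null_nat ldist_nat rdist_nat ldist_sym rdist_sym
        rdist_add_assoc ldist_add_assoc ldist_mult_assoc rdist_mult_assoc ldist_rdist_mult_assoc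
        null_null lnull_ldist rnull_rdist runit_lnull lunit_rnull lnull_assoc lnull_rnull_assoc
        rnull_assoc ldist_add_lunit rdist_add_lunit ldist_add_runit rdist_add_runit
        ldist_mult_lunit rdist_mult_runit)

lemma tight_S: "tight_braided_bimonoidal_category S"
  apply (intro tight_braided_bimonoidal_category.intro tight_braided_bimonoidal_category_axioms.intro
      braided_bimonoidal_category.intro braided_bimonoidal_category_axioms.intro bimonoidal_S braided_mult_S;
      (elim ObjE homE)?; hypsubst?)
  by (simp_all add: folds ldist_braid rdist_braid lnull_braid rnull_braid)

section \<open>The equivalence\<close>

text \<open>
  \<open>G\<close> evaluates, and its structure maps are the frames themselves. \<open>F\<close> is the assignment \<open>N\<close> on
  atoms from \<open>C\<close>; its structure maps are represented by identities of \<open>C\<close> between two expressions of equal value.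
\<close>

definition G :: "('p, 'p \<times> 'm \<times> 'p, 'o, 'm) bimon_fun_data" where
  "G = \<lparr> onObj = ev, onArr = (\<lambda>f. fst (snd f)), add2 = \<phi>p, add0 = \<phi>0, mult2 = \<phi>t, mult0 = \<phi>1 \<rparr>"

definition F :: "('o, 'm, 'p, 'p \<times> 'm \<times> 'p) bimon_fun_data" where
  "F = \<lparr> onObj = g, onArr = (\<lambda>f. N (R (Dom C f)) f (R (Cod C f))),
    add2 = (\<lambda>A B. N (Plus (R A) (R B)) (Id C (A \<oplus> B)) (R (A \<oplus> B))),
    add0 = N Zero (Id C Z) (R Z),
    mult2 = (\<lambda>A B. N (Times (R A) (R B)) (Id C (A \<otimes> B)) (R (A \<otimes> B))),
    mult0 = N One (Id C U) (R U) \<rparr>"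

lemma fold_F:
  "onObj F A = nf (R A)" "onArr F f = N (R (Dom C f)) f (R (Cod C f))"
  "add2 F A B = N (Plus (R A) (R B)) (Id C (A \<oplus> B)) (R (A \<oplus> B))"
  "add0 F = N Zero (Id C Z) (R Z)"
  "mult2 F A B = N (Times (R A) (R B)) (Id C (A \<otimes> B)) (R (A \<otimes> B))"
  "mult0 F = N One (Id C U) (R U)"
  by (simp_all add: F_def nf_eqs)

lemma functor_F: "cat_functor C S F"
  by (intro cat_functor.intro cat_functor_axioms.intro P.category_axioms category_S)
    (auto simp: folds fold_F)

lemma functor_add_F:
  "symmetric_monoidal_functor C (add C) (add_sym C) S (add S) (add_sym S) F (add2 F) (add0 F)"
  apply (intro symmetric_monoidal_functor.intro braided_monoidal_functor.intro functor_F
      braided_monoidal_functor_axioms.intro P.symmetric_monoidal_category_axioms symmetric_add_S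
      P.braided_monoidal_category_axioms symmetric_monoidal_category.axioms(1)[OF symmetric_add_S])
  by (auto simp: folds fold_F)

lemma functor_mult_F:
  "braided_monoidal_functor C (mult C) (mult_braid C) S (mult S) (mult_braid S) F (mult2 F) (mult0 F)"
  apply (intro braided_monoidal_functor.intro functor_F braided_monoidal_functor_axioms.intro
      B.braided_monoidal_category_axioms braided_mult_S)
  by (auto simp: folds fold_F)

lemma strong_F: "strong_braided_bimonoidal_functor C S F"
  apply (intro strong_braided_bimonoidal_functor.intro strong_braided_bimonoidal_functor_axioms.intro
      braided_bimonoidal_functor.intro braided_bimonoidal_functor_axioms.intro
      functor_add_F functor_mult_F braided_bimonoidal_category_axioms
      tight_braided_bimonoidal_category.axioms(1)[OF tight_S])
  by (auto simp: folds fold_F)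

lemma functor_G: "cat_functor S C G"
  by (intro cat_functor.intro cat_functor_axioms.intro P.category_axioms category_S)
    (auto simp: S_def G_def hom_def)

lemma functor_add_G:
  "symmetric_monoidal_functor S (add S) (add_sym S) C (add C) (add_sym C) G (add2 G) (add0 G)"
  apply (intro symmetric_monoidal_functor.intro braided_monoidal_functor.intro functor_G
      braided_monoidal_functor_axioms.intro P.symmetric_monoidal_category_axioms symmetric_add_S
      P.braided_monoidal_category_axioms symmetric_monoidal_category.axioms(1)[OF symmetric_add_S])
  by (auto simp: S_def G_def hom_def N_def nf_eqs frame_eqs)

lemma functor_mult_G:
  "braided_monoidal_functor S (mult S) (mult_braid S) C (mult C) (mult_braid C) G (mult2 G) (mult0 G)"
  apply (intro braided_monoidal_functor.intro functor_G braided_monoidal_functor_axioms.intro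
      B.braided_monoidal_category_axioms braided_mult_S)
  by (auto simp: S_def G_def hom_def N_def nf_eqs frame_eqs)

lemma strong_G: "strong_braided_bimonoidal_functor S C G"
  apply (intro strong_braided_bimonoidal_functor.intro strong_braided_bimonoidal_functor_axioms.intro
      braided_bimonoidal_functor.intro braided_bimonoidal_functor_axioms.intro
      functor_add_G functor_mult_G braided_bimonoidal_category_axioms
      tight_braided_bimonoidal_category.axioms(1)[OF tight_S])
  by (auto simp: S_def G_def hom_def N_def nf_eqs frame_eqs)

lemma adjoint_equivalence_F_G:
  "adjoint_equivalence C S F G \<kappa> (\<lambda>P. N (R (ev P)) (Id C (ev P)) (L P))"
  apply (intro adjoint_equivalence.intro adjoint_equivalence_axioms.intro functor_F functor_G)
  by (auto simp: Obj_S intro!: iso_N) (auto simp: S_def G_def F_def hom_def N_def nf_eqs frame_eqs)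

end

section \<open>Strictness\<close>

text \<open>
  The compatibilities of frames that turn the structure maps of \<open>S\<close> into identities.
\<close>

locale strict_transport = transport +
  assumes pl_assoc: "\<lbrakk>P \<in> X; Q \<in> X; T \<in> X\<rbrakk> \<Longrightarrow> pl (pl P Q) T = pl P (pl Q T)"
    and pl_unit: "P \<in> X \<Longrightarrow> pl ze P = P" "P \<in> X \<Longrightarrow> pl P ze = P"
    and tm_assoc: "\<lbrakk>P \<in> X; Q \<in> X; T \<in> X\<rbrakk> \<Longrightarrow> tm (tm P Q) T = tm P (tm Q T)"
    and tm_unit: "P \<in> X \<Longrightarrow> tm un P = P" "P \<in> X \<Longrightarrow> tm P un = P"
    and tm_zero: "P \<in> X \<Longrightarrow> tm ze P = ze" "P \<in> X \<Longrightarrow> tm P ze = ze"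
    and tm_pl: "\<lbrakk>P \<in> X; Q \<in> X; T \<in> X\<rbrakk> \<Longrightarrow> tm (pl P Q) T = pl (tm P T) (tm Q T)"
    and \<phi>p_assoc: "\<lbrakk>P \<in> X; Q \<in> X; T \<in> X\<rbrakk> \<Longrightarrow>
      \<phi>p (pl P Q) T \<cdot> (\<phi>p P Q \<boxplus> Id C (ev T)) =
      \<phi>p P (pl Q T) \<cdot> (Id C (ev P) \<boxplus> \<phi>p Q T) \<cdot> \<alpha>p (ev P) (ev Q) (ev T)"
    and \<phi>p_unit: "P \<in> X \<Longrightarrow> \<phi>p ze P \<cdot> (\<phi>0 \<boxplus> Id C (ev P)) = lp (ev P)"
      "P \<in> X \<Longrightarrow> \<phi>p P ze \<cdot> (Id C (ev P) \<boxplus> \<phi>0) = rp (ev P)"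
    and \<phi>t_assoc: "\<lbrakk>P \<in> X; Q \<in> X; T \<in> X\<rbrakk> \<Longrightarrow>
      \<phi>t (tm P Q) T \<cdot> (\<phi>t P Q \<boxtimes> Id C (ev T)) =
      \<phi>t P (tm Q T) \<cdot> (Id C (ev P) \<boxtimes> \<phi>t Q T) \<cdot> \<alpha>t (ev P) (ev Q) (ev T)"
    and \<phi>t_unit: "P \<in> X \<Longrightarrow> \<phi>t un P \<cdot> (\<phi>1 \<boxtimes> Id C (ev P)) = lt (ev P)"
      "P \<in> X \<Longrightarrow> \<phi>t P un \<cdot> (Id C (ev P) \<boxtimes> \<phi>1) = rt (ev P)"
    and \<phi>t_zero: "P \<in> X \<Longrightarrow> \<phi>t ze P \<cdot> (\<phi>0 \<boxtimes> Id C (ev P)) = \<phi>0 \<cdot> l0 (ev P)"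
      "P \<in> X \<Longrightarrow> \<phi>t P ze \<cdot> (Id C (ev P) \<boxtimes> \<phi>0) = \<phi>0 \<cdot> r0 (ev P)"
    and \<phi>t_pl: "\<lbrakk>P \<in> X; Q \<in> X; T \<in> X\<rbrakk> \<Longrightarrow>
      \<phi>t (pl P Q) T \<cdot> (\<phi>p P Q \<boxtimes> Id C (ev T)) =
      \<phi>p (tm P T) (tm Q T) \<cdot> (\<phi>t P T \<boxplus> \<phi>t Q T) \<cdot> \<delta>r (ev P) (ev Q) (ev T)"
begin

lemma N_eq_Id:
  assumes "nf e = T" "nf e' = T" "frame e = frame e' \<cdot> m" "wf e" "wf e'" "m \<in> Arr C" "Dom C m = val e" "Cod C m = val e'"
  shows "N e m e' = Id S T"
proof -
  have "frame e' \<cdot> m \<cdot> inverse_arrow C (frame e) = (frame e' \<cdot> m) \<cdot> inverse_arrow C (frame e)"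
    using assms(4-8) by simp
  also have "\<dots> = Id C (ev T)"
    unfolding assms(3)[symmetric] using assms(1,4) by simp
  finally show ?thesis by (simp add: N_def S_def assms(1,2))
qed

lemma strict_add_S: "strict_monoidal_category S (add S)"
proof (intro strict_monoidal_category.intro strict_monoidal_category_axioms.intro monoidal_add_S conjI)
  fix P Q T assume "P \<in> Obj S" "Q \<in> Obj S" "T \<in> Obj S"
  then have [simp]: "P \<in> X" "Q \<in> X" "T \<in> X" by (simp_all add: Obj_S)
  have "assoc (add S) P Q T = N (Plus (Plus (L P) (L Q)) (L T)) (\<alpha>p (ev P) (ev Q) (ev T))
      (Plus (L P) (Plus (L Q) (L T)))" by (simp add: S_def)
  also have "\<dots> = Id S (tensor (add S) P (tensor (add S) Q T))"
    by (rule N_eq_Id) (simp_all add: S_def nf_eqs frame_eqs pl_assoc \<phi>p_assoc)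
  finally show "assoc (add S) P Q T = \<dots>" .
next
  fix P assume "P \<in> Obj S"
  then have [simp]: "P \<in> X" by (simp add: Obj_S)
  have "lunit (add S) P = N (Plus Zero (L P)) (lp (ev P)) (L P)" by (simp add: S_def)
  also have "\<dots> = Id S P"
    by (rule N_eq_Id) (simp_all add: nf_eqs frame_eqs pl_unit \<phi>p_unit)
  finally show "lunit (add S) P = \<dots>" .
  have "runit (add S) P = N (Plus (L P) Zero) (rp (ev P)) (L P)" by (simp add: S_def)
  also have "\<dots> = Id S P"
    by (rule N_eq_Id) (simp_all add: nf_eqs frame_eqs pl_unit \<phi>p_unit)
  finally show "runit (add S) P = \<dots>" .
qed (simp_all add: S_def pl_assoc pl_unit)

lemma strict_mult_S: "strict_monoidal_category S (mult S)"
proof (intro strict_monoidal_category.intro strict_monoidal_category_axioms.intro monoidal_mult_S conjI)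
  fix P Q T assume "P \<in> Obj S" "Q \<in> Obj S" "T \<in> Obj S"
  then have [simp]: "P \<in> X" "Q \<in> X" "T \<in> X" by (simp_all add: Obj_S)
  have "assoc (mult S) P Q T = N (Times (Times (L P) (L Q)) (L T)) (\<alpha>t (ev P) (ev Q) (ev T))
      (Times (L P) (Times (L Q) (L T)))" by (simp add: S_def)
  also have "\<dots> = Id S (tensor (mult S) P (tensor (mult S) Q T))"
    by (rule N_eq_Id) (simp_all add: S_def nf_eqs frame_eqs tm_assoc \<phi>t_assoc)
  finally show "assoc (mult S) P Q T = \<dots>" .
next
  fix P assume "P \<in> Obj S"
  then have [simp]: "P \<in> X" by (simp add: Obj_S)
  have "lunit (mult S) P = N (Times One (L P)) (lt (ev P)) (L P)" by (simp add: S_def)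
  also have "\<dots> = Id S P"
    by (rule N_eq_Id) (simp_all add: nf_eqs frame_eqs tm_unit \<phi>t_unit)
  finally show "lunit (mult S) P = \<dots>" .
  have "runit (mult S) P = N (Times (L P) One) (rt (ev P)) (L P)" by (simp add: S_def)
  also have "\<dots> = Id S P"
    by (rule N_eq_Id) (simp_all add: nf_eqs frame_eqs tm_unit \<phi>t_unit)
  finally show "runit (mult S) P = \<dots>" .
qed (simp_all add: S_def tm_assoc tm_unit)

lemma null_S:
  assumes "P \<in> Obj S"
  shows "tensor (mult S) ze P = ze" "tensor (mult S) P ze = ze"
    "lnull S P = Id S ze" "rnull S P = Id S ze"
proof -
  have [simp]: "P \<in> X" using assms by (simp add: Obj_S)
  show "tensor (mult S) ze P = ze" "tensor (mult S) P ze = ze"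
    by (simp_all add: S_def tm_zero)
  have "lnull S P = N (Times Zero (L P)) (l0 (ev P)) Zero" by (simp add: S_def)
  also have "\<dots> = Id S ze"
    by (rule N_eq_Id) (simp_all add: nf_eqs frame_eqs tm_zero \<phi>t_zero)
  finally show "lnull S P = \<dots>" .
  have "rnull S P = N (Times (L P) Zero) (r0 (ev P)) Zero" by (simp add: S_def)
  also have "\<dots> = Id S ze"
    by (rule N_eq_Id) (simp_all add: nf_eqs frame_eqs tm_zero \<phi>t_zero)
  finally show "rnull S P = \<dots>" .
qed

text \<open>
  The axioms \<open>lnull_braid\<close> and \<open>rnull_braid\<close> express the braiding with zero through the zero
  isomorphisms, which are identities in \<open>S\<close>.
\<close>

lemma braid_null_S:
  assumes "P \<in> Obj S"
  shows "mult_braid S P ze = Id S ze" "mult_braid S ze P = Id S ze"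
proof -
  interpret S: tight_braided_bimonoidal_category S by (rule tight_S)
  have [simp]: "P \<in> X" using assms by (simp add: Obj_S)
  have ze: "unit_obj (add S) = ze" "ze \<in> Obj S" by (simp_all add: S_def)
  note n = null_S[OF assms]
  have "Comp S (Id S ze) (mult_braid S P ze) = Id S ze" "Comp S (Id S ze) (mult_braid S ze P) = Id S ze"
    using S.lnull_braid[OF assms] S.rnull_braid[OF assms] by (simp_all add: n ze)
  then show "mult_braid S P ze = Id S ze" "mult_braid S ze P = Id S ze"
    using assms ze(2) by (simp_all add: n)
qed

theorem permbraided_S: "right_permbraided_category S"
proof (intro right_permbraided_category.intro right_permbraided_category_axioms.intro
    tight_S strict_add_S strict_mult_S)
  have ze: "unit_obj (add S) = ze" by (simp add: S_def)
  fix P assume P: "P \<in> Obj S"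
  show "tensor (mult S) (unit_obj (add S)) P = unit_obj (add S) \<and> lnull S P = Id S (unit_obj (add S))"
    "tensor (mult S) P (unit_obj (add S)) = unit_obj (add S) \<and> rnull S P = Id S (unit_obj (add S))"
    "tensor (mult S) P (unit_obj (add S)) = tensor (mult S) (unit_obj (add S)) P \<and>
      mult_braid S P (unit_obj (add S)) = Id S (tensor (mult S) (unit_obj (add S)) P)"
    "tensor (mult S) (unit_obj (add S)) P = tensor (mult S) P (unit_obj (add S)) \<and>
      mult_braid S (unit_obj (add S)) P = Id S (tensor (mult S) P (unit_obj (add S)))"
    by (simp_all add: ze null_S[OF P] braid_null_S[OF P])
next
  fix P Q T assume "P \<in> Obj S" "Q \<in> Obj S" "T \<in> Obj S"
  then have [simp]: "P \<in> X" "Q \<in> X" "T \<in> X" by (simp_all add: Obj_S)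
  have "rdist S P Q T = N (Times (Plus (L P) (L Q)) (L T)) (\<delta>r (ev P) (ev Q) (ev T))
      (Plus (Times (L P) (L T)) (Times (L Q) (L T)))" by (simp add: S_def)
  also have "\<dots> = Id S (tensor (add S) (tensor (mult S) P T) (tensor (mult S) Q T))"
    by (rule N_eq_Id) (simp_all add: S_def nf_eqs frame_eqs tm_pl \<phi>t_pl)
  finally show "tensor (mult S) (tensor (add S) P Q) T =
      tensor (add S) (tensor (mult S) P T) (tensor (mult S) Q T) \<and>
    rdist S P Q T = Id S (tensor (add S) (tensor (mult S) P T) (tensor (mult S) Q T))"
    by (simp add: S_def tm_pl)
qed

end

section \<open>Polynomials as formal expressions\<close>

primrec enc_mono :: "'o list \<Rightarrow> 'o rig_expr" where
  "enc_mono [] = One"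
| "enc_mono (x # m) = Times (Gen x) (enc_mono m)"

primrec enc :: "'o list list \<Rightarrow> 'o rig_expr" where
  "enc [] = Zero"
| "enc (m # P) = Plus (enc_mono m) (enc P)"

definition dec :: "'o rig_expr \<Rightarrow> 'o list list" where
  "dec = inv enc"

lemma inj_enc_mono: "inj enc_mono"
proof (rule injI)
  show "enc_mono m = enc_mono n \<Longrightarrow> m = n" for m n :: "'a list"
    by (induction m arbitrary: n; case_tac n) auto
qed

lemma inj_enc: "inj enc"
proof (rule injI)
  show "enc P = enc Q \<Longrightarrow> P = Q" for P Q :: "'a list list"
    by (induction P arbitrary: Q; case_tac Q) (auto dest: injD[OF inj_enc_mono])
qed

declare enc.simps [simp del]

lemma dec_enc [simp]: "dec (enc P) = P"
  by (simp add: dec_def inj_enc)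

text \<open>
  An object \<open>A\<close> is represented by the polynomial with one monomial of one letter, whose value is
  \<open>A \<otimes> U \<oplus> Z\<close>.
\<close>

lemma (in tight_braided_bimonoidal_category) strict_transport_enc:
  "strict_transport C (enc ` {P. polynomial P}) (\<lambda>p. poly (dec p))
    (\<lambda>p q. enc (dec p @ dec q)) (\<lambda>p q. enc (poly_mult (dec p) (dec q))) (enc []) (enc [[]])
    (\<lambda>p q. add_frame (dec p) (dec q)) (\<lambda>p q. mult_frame (dec p) (dec q))
    (Id C Z) (inverse_arrow C (rp U))
    (\<lambda>A. enc [[A]]) (\<lambda>A. inverse_arrow C (rp (A \<otimes> U)) \<cdot> inverse_arrow C (rt A))"
  apply unfold_locales
  apply (auto simp: add_frame_assoc add_frame_Nil mult_frame_assoc mult_frame_lunit mult_frame_runit mult_frame_Nil mult_frame_add_frame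
      poly_mult_append poly_mult_assoc inj_image_mem_iff[OF inj_enc] simp del: mult_frame.simps(2))
  done

theorem mainTheorem10:
  fixes C :: "('o, 'm) braided_bimon_data"
  assumes "tight_braided_bimonoidal_category C"
  shows "\<exists>(A :: ('o rig_expr, 'o rig_expr \<times> 'm \<times> 'o rig_expr) braided_bimon_data)
          (F :: ('o, 'm, 'o rig_expr, 'o rig_expr \<times> 'm \<times> 'o rig_expr) bimon_fun_data)
          (G :: ('o rig_expr, 'o rig_expr \<times> 'm \<times> 'o rig_expr, 'o, 'm) bimon_fun_data)
          \<eta> \<epsilon>.
        right_permbraided_category A \<and>
        adjoint_equivalence C A F G \<eta> \<epsilon> \<and>
        strong_braided_bimonoidal_functor C A F \<and>
        strong_braided_bimonoidal_functor A C G"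
proof -
  interpret tight_braided_bimonoidal_category C by (rule assms)
  note t = strict_transport_enc
  note u = strict_transport.axioms(1)[OF t]
  show ?thesis
    using strict_transport.permbraided_S[OF t] transport.adjoint_equivalence_F_G[OF u]
      transport.strong_F[OF u] transport.strong_G[OF u] by blast
qed

end
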